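(* Let $A$ be a finite connected Apollonian network with edge set $E(A)$. Then for every real $\beta>1$ the function $x\mapsto T_A(x)^{-\beta}$ is completely monotone on $(0,\infty)^{E(A)}$. Hence $A\in\mathcal{G}_\beta$ for every $\beta$ with $1<\beta<\tfrac32$.
   Context: A finite Apollonian network is a graph obtained from a plane triangle by finitely many repetitions of the following step: select a triangular face, insert a new vertex into that face, and join the new vertex to the three boundary vertices of the face. For a finite connected graph $G=(V,E)$, the spanning-tree polynomial is $T_G(x)=\sum_{T\in\mathcal{T}(G)}\prod_{e\in T}x_e$, $x=(x_e)_{e\in E}$, where $\mathcal{T}(G)$ is the set of spanning trees of $G$. A function $f\in C^\infty((0,\infty)^n)$ is completely monotone if $(-1)^{|\alpha|}\partial^\alpha f(x)\ge 0$ for all multi-indices $\alpha\in\mathbb{N}^n$ and all $x\in(0,\infty)^n$. For $\beta>0$, $\mathcal{G}_\beta$ denotes the class of finite connected graphs $G$ such that $T_G^{-\beta}$ is completely monotone on $(0,\infty)^E$. *)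

theory Defs
  imports "HOL-Analysis.Analysis" "HOL-Library.Multiset" "HOL-Library.FuncSet"
begin

section \<open>Finite connected graphs\<close>

record 'v ugraph =
  verts :: "'v set"
  edges :: "'v set set"

definition simple_graph :: "'v ugraph \<Rightarrow> bool" where
  "simple_graph G \<longleftrightarrow> (\<forall>e\<in>edges G. e \<subseteq> verts G \<and> card e = 2)"

definition connected_graph :: "'v ugraph \<Rightarrow> bool" where
  "connected_graph G \<longleftrightarrow> verts G \<noteq> {} \<and>
     (\<forall>u\<in>verts G. \<forall>v\<in>verts G. (u, v) \<in> {(a, b). {a, b} \<in> edges G}\<^sup>*)"

definition finite_connected_graph :: "'v ugraph \<Rightarrow> bool" where
  "finite_connected_graph G \<longleftrightarrow> finite (verts G) \<and> simple_graph G \<and> connected_graph G"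

definition is_cycle :: "'v ugraph \<Rightarrow> 'v list \<Rightarrow> bool" where
  "is_cycle G vs \<longleftrightarrow> 3 \<le> length vs \<and> distinct vs \<and>
     (\<forall>i<length vs. {vs ! i, vs ! (Suc i mod length vs)} \<in> edges G)"

definition tree :: "'v ugraph \<Rightarrow> bool" where
  "tree G \<longleftrightarrow> connected_graph G \<and> (\<nexists>vs. is_cycle G vs)"

text \<open>A spanning tree of \<open>G\<close> is identified with its set of edges.\<close>

definition spanning_trees :: "'v ugraph \<Rightarrow> 'v set set set" where
  "spanning_trees G = {T. T \<subseteq> edges G \<and> tree \<lparr>verts = verts G, edges = T\<rparr>}"

definition spanning_tree_poly :: "'v ugraph \<Rightarrow> ('v set \<Rightarrow> real) \<Rightarrow> real" where
  "spanning_tree_poly G x = (\<Sum>T\<in>spanning_trees G. \<Prod>e\<in>T. x e)"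


section \<open>Apollonian networks\<close>

text \<open>
  A plane triangulation is recorded by its graph together with the multiset of its faces, each face
  being given by the set of its three boundary vertices.  A multiset is needed because the inner and
  the outer face of the initial triangle have the same boundary.  The outer face may be selected for
  an insertion like any other face.
\<close>

inductive plane_apollonian :: "'v ugraph \<Rightarrow> 'v set multiset \<Rightarrow> bool" where
  triangle: "distinct [a, b, c] \<Longrightarrow>
     plane_apollonian \<lparr>verts = {a, b, c}, edges = {{a, b}, {b, c}, {a, c}}\<rparr>
       {#{a, b, c}, {a, b, c}#}"
| insert_vertex: "plane_apollonian G F \<Longrightarrow> {a, b, c} \<in># F \<Longrightarrow> distinct [a, b, c] \<Longrightarrow> v \<notin> verts G \<Longrightarrow>
     plane_apollonian
       \<lparr>verts = insert v (verts G), edges = edges G \<union> {{v, a}, {v, b}, {v, c}}\<rparr>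
       (F - {#{a, b, c}#} + {#{v, a, b}, {v, b, c}, {v, a, c}#})"

definition apollonian_network :: "'v ugraph \<Rightarrow> bool" where
  "apollonian_network G \<longleftrightarrow> (\<exists>F. plane_apollonian G F)"

lemma plane_apollonian_finite_connected:
  assumes "plane_apollonian G F"
  shows "finite_connected_graph G \<and> (\<forall>f\<in>#F. f \<subseteq> verts G)"
  using assms
proof induction
  case (triangle a b c)
  let ?G = "\<lparr>verts = {a, b, c}, edges = {{a, b}, {b, c}, {a, c}}\<rparr>"
  have "(u, v) \<in> {(a, b). {a, b} \<in> edges ?G}\<^sup>*" if "u \<in> {a, b, c}" "v \<in> {a, b, c}" for u v
    using that by (cases "u = v") (auto intro!: r_into_rtrancl simp: insert_commute)
  then have "connected_graph ?G"
    unfolding connected_graph_def by simp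
  with triangle show ?case
    by (auto simp: finite_connected_graph_def simple_graph_def)
next
  case (insert_vertex G F a b c v)
  let ?H = "\<lparr>verts = insert v (verts G), edges = edges G \<union> {{v, a}, {v, b}, {v, c}}\<rparr>"
  let ?r = "{(a, b). {a, b} \<in> edges G}" and ?s = "{(a, b). {a, b} \<in> edges ?H}"
  have abc: "{a, b, c} \<subseteq> verts G"
    using insert_vertex by auto
  have "?r\<^sup>* \<subseteq> ?s\<^sup>*"
    by (rule rtrancl_mono) auto
  then have old: "(u, w) \<in> ?s\<^sup>*" if "u \<in> verts G" "w \<in> verts G" for u w
    using insert_vertex.IH that by (auto simp: finite_connected_graph_def connected_graph_def)
  have "(v, a) \<in> ?s" "(a, v) \<in> ?s"
    by (auto simp: insert_commute)
  then have "(u, w) \<in> ?s\<^sup>*" if "u \<in> insert v (verts G)" "w \<in> insert v (verts G)" for u w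
    using that old abc
    by (metis (no_types, lifting) converse_rtrancl_into_rtrancl insertE insert_subset
        rtrancl.rtrancl_into_rtrancl rtrancl.rtrancl_refl)
  then have "connected_graph ?H"
    unfolding connected_graph_def by simp
  moreover have "simple_graph ?H" "finite (verts ?H)"
    using insert_vertex abc by (auto simp: finite_connected_graph_def simple_graph_def card_insert_if)
  ultimately show ?case
    using insert_vertex.IH abc
    by (auto simp: finite_connected_graph_def dest: in_diffD)
qed

lemma apollonian_network_finite_connected:
  "apollonian_network G \<Longrightarrow> finite_connected_graph G"
  using plane_apollonian_finite_connected by (auto simp: apollonian_network_def)


section \<open>Complete monotonicity\<close>

definition open_orthant :: "'i set \<Rightarrow> ('i \<Rightarrow> real) set" where
  "open_orthant I = I \<rightarrow>\<^sub>E {0<..}"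

definition partial_deriv :: "'i \<Rightarrow> (('i \<Rightarrow> real) \<Rightarrow> real) \<Rightarrow> ('i \<Rightarrow> real) \<Rightarrow> real" where
  "partial_deriv i f x = deriv (\<lambda>t. f (x(i := t))) (x i)"

definition iterated_partial_deriv :: "'i list \<Rightarrow> (('i \<Rightarrow> real) \<Rightarrow> real) \<Rightarrow> ('i \<Rightarrow> real) \<Rightarrow> real" where
  "iterated_partial_deriv es f = foldr partial_deriv es f"

text \<open>
  \<open>C\<^sup>\<infinity>\<close> on \<open>(0,\<infinity>)\<^sup>I\<close> for finite \<open>I\<close>: all iterated partial derivatives, in any order, exist and are
  continuous.  The topology on \<open>'i \<Rightarrow> real\<close> is the product topology, which induces the Euclidean
  topology on the orthant.
\<close>

definition smooth_on_orthant :: "'i set \<Rightarrow> (('i \<Rightarrow> real) \<Rightarrow> real) \<Rightarrow> bool" where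
  "smooth_on_orthant I f \<longleftrightarrow> (\<forall>es\<in>lists I.
     continuous_on (open_orthant I) (iterated_partial_deriv es f) \<and>
     (\<forall>i\<in>I. \<forall>x\<in>open_orthant I.
        (\<lambda>t. iterated_partial_deriv es f (x(i := t))) differentiable (at (x i))))"

text \<open>
  The derivative \<open>\<partial>\<^sup>\<alpha>\<close> is written as an iterated partial derivative along a list \<open>es\<close> in which each
  index \<open>i\<close> occurs \<open>\<alpha> i\<close> times.  All such lists are admitted; for smooth \<open>f\<close> the derivative does not
  depend on the choice, by the symmetry of mixed partial derivatives.
\<close>

definition completely_monotone :: "'i set \<Rightarrow> (('i \<Rightarrow> real) \<Rightarrow> real) \<Rightarrow> bool" where
  "completely_monotone I f \<longleftrightarrow> smooth_on_orthant I f \<and>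
     (\<forall>\<alpha> :: 'i \<Rightarrow> nat. \<forall>es\<in>lists I. (\<forall>i\<in>I. count_list es i = \<alpha> i) \<longrightarrow>
       (\<forall>x\<in>open_orthant I. 0 \<le> (-1) ^ (\<Sum>i\<in>I. \<alpha> i) * iterated_partial_deriv es f x))"

definition cm_graphs :: "real \<Rightarrow> 'v ugraph set" where
  "cm_graphs \<beta> = {G. finite_connected_graph G \<and>
     completely_monotone (edges G) (\<lambda>x. spanning_tree_poly G x powr (- \<beta>))}"

end

theory Submission
  imports Defs "HOL-Probability.Distributions"
begin

text \<open>
  For every face-labelled Apollonian network and every \<open>\<beta> > 1\<close> the function \<open>T\<^sub>A(x)\<^bsup>-\<beta>\<^esup>\<close> is the Laplace
  transform of a measure on edge weights \<open>t\<close> whose restriction to every face consists of the squared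
  side lengths of a Euclidean triangle. Inserting \<open>v\<close> into a face \<open>abc\<close>, with new variables
  \<open>p, q, r\<close> and \<open>S = p + q + r\<close>, gives by the star-triangle relation
  \<open>T\<^sub>H = S T\<^sub>G(x\<^sub>a\<^sub>b + p q/S, x\<^sub>b\<^sub>c + q r/S, x\<^sub>a\<^sub>c + p r/S)\<close>, so that the induction step needs
  \<open>S\<^bsup>-\<beta>\<^esup> exp(-(p q t\<^sub>a\<^sub>b + q r t\<^sub>b\<^sub>c + p r t\<^sub>a\<^sub>c)/S)\<close> to be a Laplace transform in \<open>(p, q, r)\<close>. If the
  \<open>t\<close> are squared distances of points \<open>A, B, C\<close> in the plane, a Gaussian integral over the position
  \<open>P\<close> of \<open>v\<close> in the plane and a Gamma integral over its squared height \<open>s\<close> produce exactly this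
  function, the weights of the new edges being \<open>|P - A|\<^sup>2 + s\<close>, \<open>|P - B|\<^sup>2 + s\<close>, \<open>|P - C|\<^sup>2 + s\<close>. The
  exponents \<open>-1\<close> and \<open>-(\<beta> - 1)\<close> of \<open>S\<close> come from the two integrals, whence \<open>\<beta> > 1\<close>; and the three
  new faces are again Euclidean triangles.
\<close>

section \<open>Spanning trees\<close>

abbreviation adj :: "'v set set \<Rightarrow> ('v \<times> 'v) set" where
  "adj E \<equiv> {(a, b). {a, b} \<in> E}"

text \<open>The tool for rerouting walks: every step is replaced by a walk, where \<open>f\<close>
  is either the identity or a contraction of vertices.\<close>

lemma rtrancl_image:
  assumes "(x, y) \<in> R\<^sup>*" and "\<And>x y. (x, y) \<in> R \<Longrightarrow> (f x, f y) \<in> S\<^sup>*"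
  shows "(f x, f y) \<in> S\<^sup>*"
  using assms(1) by induction (use assms(2) in \<open>auto intro: rtrancl_trans\<close>)

lemma sym_adj_rtrancl: "(x, y) \<in> (adj E)\<^sup>* \<Longrightarrow> (y, x) \<in> (adj E)\<^sup>*"
  by (rule symD[OF sym_rtrancl]) (auto simp: sym_def insert_commute)

lemma adj_rtrancl_mono: "(x, y) \<in> (adj E)\<^sup>* \<Longrightarrow> E \<subseteq> E' \<Longrightarrow> (x, y) \<in> (adj E')\<^sup>*"
  by (erule rtrancl_mono[THEN subsetD, rotated]) auto

lemma connected_graph_root:
  assumes "r \<in> V" and "\<And>u. u \<in> V \<Longrightarrow> (r, u) \<in> (adj E)\<^sup>*"
  shows "connected_graph \<lparr>verts = V, edges = E\<rparr>"
  using assms by (auto simp: connected_graph_def intro: rtrancl_trans sym_adj_rtrancl)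

lemma simple_graph_finite_edges:
  "simple_graph \<lparr>verts = V, edges = E\<rparr> \<Longrightarrow> finite V \<Longrightarrow> finite E"
  by (rule finite_subset[of E "Pow V"]) (auto simp: simple_graph_def)

text \<open>The subtree consists of the edges from each vertex to a neighbour nearer to a fixed root.\<close>

lemma connected_graph_subtree:
  assumes "finite V" and conn: "connected_graph \<lparr>verts = V, edges = E\<rparr>"
    and simple: "simple_graph \<lparr>verts = V, edges = E\<rparr>"
  obtains E' where "E' \<subseteq> E" "connected_graph \<lparr>verts = V, edges = E'\<rparr>" "card E' + 1 = card V"
proof -
  obtain r where r: "r \<in> V"
    using conn by (auto simp: connected_graph_def)
  define d where "d v = (LEAST n. (r, v) \<in> adj E ^^ n)" for v
  have "\<exists>p. {p, v} \<in> E \<and> p \<in> V \<and> d p < d v" if v: "v \<in> V - {r}" for v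
  proof -
    have "(r, v) \<in> (adj E)\<^sup>*"
      using conn r v by (auto simp: connected_graph_def)
    then have dv: "(r, v) \<in> adj E ^^ d v"
      unfolding d_def by (auto dest!: rtrancl_imp_relpow intro: LeastI)
    with v obtain m where m: "d v = Suc m"
      by (cases "d v") auto
    with dv obtain p where p: "(r, p) \<in> adj E ^^ m" "{p, v} \<in> E"
      by auto
    have "d p \<le> m"
      unfolding d_def by (rule Least_le) (rule p)
    with p m simple show ?thesis
      by (intro exI[of _ p]) (auto simp: simple_graph_def)
  qed
  then obtain p where p: "\<And>v. v \<in> V - {r} \<Longrightarrow> {p v, v} \<in> E \<and> p v \<in> V \<and> d (p v) < d v"
    by metis
  define E' where "E' = (\<lambda>v. {p v, v}) ` (V - {r})"
  \<comment> \<open>If two vertices had the same parent edge, each would be the parent of the other,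
    although \<open>d\<close> strictly decreases towards the root.\<close>
  have "inj_on (\<lambda>v. {p v, v}) (V - {r})"
  proof (rule inj_onI)
    fix u w assume uw: "u \<in> V - {r}" "w \<in> V - {r}" "{p u, u} = {p w, w}"
    show "u = w"
    proof (rule ccontr)
      assume "u \<noteq> w"
      with uw(3) have "p u = w" "p w = u"
        by (auto simp: doubleton_eq_iff)
      with p[OF uw(1)] p[OF uw(2)] show False by simp
    qed
  qed
  then have "card E' = card (V - {r})"
    unfolding E'_def by (rule card_image)
  then have card: "card E' + 1 = card V"
    using \<open>finite V\<close> r by (metis Suc_eq_plus1 card_Suc_Diff1)
  have reach: "(r, v) \<in> (adj E')\<^sup>*" if "v \<in> V" for v
    using that
  proof (induction "d v" arbitrary: v rule: less_induct)
    case less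
    show ?case
    proof (cases "v = r")
      case False
      with less.prems have v: "v \<in> V - {r}" by simp
      then have "(p v, v) \<in> adj E'" by (auto simp: E'_def)
      with less.hyps[of "p v"] p[OF v] show ?thesis
        by (meson rtrancl.rtrancl_into_rtrancl)
    qed simp
  qed
  have "E' \<subseteq> E"
    using p by (auto simp: E'_def)
  with connected_graph_root[OF r reach] card show thesis
    by (intro that[of E']) auto
qed

lemma connected_graph_card:
  assumes "finite V" "connected_graph \<lparr>verts = V, edges = E\<rparr>" "simple_graph \<lparr>verts = V, edges = E\<rparr>"
  shows "card V \<le> card E + 1"
proof -
  have "finite E"
    using assms simple_graph_finite_edges by blast
  moreover obtain E' where "E' \<subseteq> E" "card E' + 1 = card V"
    using connected_graph_subtree[OF assms] .
  ultimately show ?thesis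
    by (metis add_le_mono1 card_mono)
qed

text \<open>When a step is prepended to a path that already visits \<open>u\<close>, the part of the
  path before \<open>u\<close> is cut off instead.\<close>

lemma rtrancl_distinct_list:
  assumes "(u, w) \<in> R\<^sup>*"
  shows "\<exists>vs. vs \<noteq> [] \<and> distinct vs \<and> hd vs = u \<and> last vs = w \<and>
    (\<forall>i. Suc i < length vs \<longrightarrow> (vs ! i, vs ! Suc i) \<in> R)"
  using assms
proof (induction rule: converse_rtrancl_induct)
  case base
  show ?case by (intro exI[of _ "[w]"]) auto
next
  case (step u u')
  then obtain vs where vs: "vs \<noteq> []" "distinct vs" "hd vs = u'" "last vs = w"
    "\<And>i. Suc i < length vs \<Longrightarrow> (vs ! i, vs ! Suc i) \<in> R" by blast
  show ?case
  proof (cases "u \<in> set vs")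
    case True
    then obtain k where k: "k < length vs" "vs ! k = u"
      by (auto simp: in_set_conv_nth)
    show ?thesis
      by (intro exI[of _ "drop k vs"]) (use k vs in \<open>auto simp: hd_drop_conv_nth\<close>)
  next
    case False
    have "((u # vs) ! i, (u # vs) ! Suc i) \<in> R" if "Suc i < length (u # vs)" for i
      using that vs step.hyps by (cases i) (auto simp: hd_conv_nth)
    with False vs show ?thesis
      by (intro exI[of _ "u # vs"]) auto
  qed
qed

text \<open>The rest of the cycle joins the two ends of the closing edge, so every walk through that
  edge can be rerouted.\<close>

lemma is_cycle_edge_redundant:
  assumes cyc: "is_cycle \<lparr>verts = V, edges = E\<rparr> vs"
    and conn: "connected_graph \<lparr>verts = V, edges = E\<rparr>"
  shows "connected_graph \<lparr>verts = V, edges = E - {{last vs, hd vs}}\<rparr>"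
    and "{last vs, hd vs} \<in> E"
proof -
  let ?n = "length vs" and ?E = "E - {{last vs, hd vs}}"
  have len: "3 \<le> ?n" and dist: "distinct vs"
    and edge: "\<And>i. i < ?n \<Longrightarrow> {vs ! i, vs ! (Suc i mod ?n)} \<in> E"
    using cyc by (auto simp: is_cycle_def)
  have hl: "hd vs = vs ! 0" "last vs = vs ! (?n - 1)"
    using len hd_conv_nth[of vs] last_conv_nth[of vs] by fastforce+
  show "{last vs, hd vs} \<in> E"
  proof -
    have "Suc (?n - 1) mod ?n = 0"
      using len by (cases vs) auto
    with edge[of "?n - 1"] len show ?thesis
      by (auto simp: hl)
  qed
  have "(vs ! 0, vs ! i) \<in> (adj ?E)\<^sup>*" if "i < ?n" for i
    using that
  proof (induction i)
    case (Suc i)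
    \<comment> \<open>An edge along the list coincides with the closing edge only in a list of two
      vertices, which the bound 3 in \<open>is_cycle\<close> excludes.\<close>
    have "{vs ! i, vs ! Suc i} \<noteq> {vs ! (?n - 1), vs ! 0}"
    proof
      assume "{vs ! i, vs ! Suc i} = {vs ! (?n - 1), vs ! 0}"
      moreover have "0 < ?n" "i < ?n" "?n - 1 < ?n"
        using Suc.prems by auto
      ultimately have "i = ?n - 1 \<and> Suc i = 0 \<or> i = 0 \<and> Suc i = ?n - 1"
        using Suc.prems by (simp only: doubleton_eq_iff nth_eq_iff_index_eq[OF dist])
      with len show False by auto
    qed
    then have "(vs ! i, vs ! Suc i) \<in> adj ?E"
      using edge[of i] Suc.prems by (auto simp: hl)
    with Suc show ?case
      by (meson Suc_lessD rtrancl.rtrancl_into_rtrancl)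
  qed simp
  from this[of "?n - 1"] len have path: "(hd vs, last vs) \<in> (adj ?E)\<^sup>*"
    by (simp add: hl)
  have "(u, w) \<in> (adj ?E)\<^sup>*" if "(u, w) \<in> (adj E)\<^sup>*" for u w
    using that
  proof (rule rtrancl_image[where f = "\<lambda>x. x"])
    fix u w assume "(u, w) \<in> adj E"
    then show "(u, w) \<in> (adj ?E)\<^sup>*"
      using path sym_adj_rtrancl[OF path]
      by (cases "{u, w} = {last vs, hd vs}") (auto simp: doubleton_eq_iff)
  qed
  then show "connected_graph \<lparr>verts = V, edges = ?E\<rparr>"
    using conn by (auto simp: connected_graph_def)
qed

text \<open>Deleting an edge of a cycle keeps the graph connected, so a connected graph with
  \<open>card V - 1\<close> edges has no cycle, by \<open>connected_graph_card\<close>. Conversely,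
  an edge outside a spanning subtree closes a cycle with a path in the subtree. The criterion turns
  acyclicity into a count that is easy to follow when edges are exchanged.\<close>

lemma tree_iff_card:
  assumes "finite V" and simple: "simple_graph \<lparr>verts = V, edges = E\<rparr>"
  shows "tree \<lparr>verts = V, edges = E\<rparr> \<longleftrightarrow>
    connected_graph \<lparr>verts = V, edges = E\<rparr> \<and> card E + 1 = card V"
proof (cases "connected_graph \<lparr>verts = V, edges = E\<rparr>")
  case conn: True
  have fin: "finite E"
    using assms simple_graph_finite_edges by blast
  have "card E + 1 \<noteq> card V" if cyc: "is_cycle \<lparr>verts = V, edges = E\<rparr> vs" for vs
  proof -
    have "simple_graph \<lparr>verts = V, edges = E - {{last vs, hd vs}}\<rparr>"
      using simple by (auto simp: simple_graph_def)
    then have "card V \<le> card (E - {{last vs, hd vs}}) + 1"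
      using connected_graph_card[OF \<open>finite V\<close> is_cycle_edge_redundant(1)[OF cyc conn]] by simp
    moreover have "card (E - {{last vs, hd vs}}) < card E"
      using is_cycle_edge_redundant(2)[OF cyc conn] fin by (rule card_Diff1_less[rotated])
    ultimately show ?thesis by simp
  qed
  moreover have "\<exists>vs. is_cycle \<lparr>verts = V, edges = E\<rparr> vs" if neq: "card E + 1 \<noteq> card V"
  proof -
    obtain E' where E': "E' \<subseteq> E" "connected_graph \<lparr>verts = V, edges = E'\<rparr>" "card E' + 1 = card V"
      using connected_graph_subtree[OF \<open>finite V\<close> conn simple] .
    with neq have "E' \<subset> E" by auto
    then obtain e where e: "e \<in> E" "e \<notin> E'" by auto
    with simple obtain u w where uw: "e = {u, w}" "u \<noteq> w" "u \<in> V" "w \<in> V"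
      by (auto simp: simple_graph_def card_2_iff)
    with E' have "(u, w) \<in> (adj E')\<^sup>*"
      by (auto simp: connected_graph_def)
    then obtain vs where vs: "vs \<noteq> []" "distinct vs" "hd vs = u" "last vs = w"
      "\<And>i. Suc i < length vs \<Longrightarrow> {vs ! i, vs ! Suc i} \<in> E'"
      using rtrancl_distinct_list[of u w "adj E'"] by auto
    \<comment> \<open>The path has at least three vertices: its ends differ, and the edge between
      them is missing from \<open>E'\<close>.\<close>
    have "length vs \<noteq> 1"
      using vs(3,4) uw by (auto simp: length_Suc_conv)
    moreover have "length vs \<noteq> 2"
      using vs(3,4) vs(5)[of 0] uw e by (auto simp: length_Suc_conv numeral_2_eq_2)
    ultimately have len: "3 \<le> length vs"
      using vs(1) by (cases "length vs") auto
    have "{vs ! i, vs ! (Suc i mod length vs)} \<in> E" if i: "i < length vs" for i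
    proof (cases "Suc i = length vs")
      case True
      then have "{vs ! i, vs ! (Suc i mod length vs)} = {last vs, hd vs}"
        using vs(1) True[symmetric] by (simp add: hd_conv_nth last_conv_nth)
      with vs uw e show ?thesis by (auto simp: insert_commute)
    next
      case False
      with i vs(5)[of i] E' show ?thesis by auto
    qed
    with len vs(2) show ?thesis
      by (auto simp: is_cycle_def)
  qed
  ultimately show ?thesis
    using conn by (auto simp: tree_def)
qed (auto simp: tree_def)

text \<open>From left to right, \<open>v\<close> is contracted to some \<open>a\<close> in
  \<open>N\<close>, and a star edge becomes a walk in \<open>K\<close>. From right to left, an edge
  of \<open>K\<close> becomes a detour of two star edges through \<open>v\<close>.\<close>

lemma connected_graph_star_iff:
  assumes v: "v \<notin> V" and F: "\<And>e. e \<in> F \<Longrightarrow> e \<subseteq> V" and N: "N \<subseteq> V"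
    and K: "connected_graph \<lparr>verts = N, edges = K\<rparr>" "\<And>e. e \<in> K \<Longrightarrow> e \<subseteq> N"
  shows "connected_graph \<lparr>verts = insert v V, edges = F \<union> (\<lambda>u. {v, u}) ` N\<rparr> \<longleftrightarrow>
    connected_graph \<lparr>verts = V, edges = F \<union> K\<rparr>" (is "?L \<longleftrightarrow> ?R")
proof
  let ?E = "F \<union> (\<lambda>u. {v, u}) ` N"
  obtain a where a: "a \<in> N"
    using K by (auto simp: connected_graph_def)
  have reach: "(u, w) \<in> (adj (F \<union> K))\<^sup>*" if "u \<in> N" "w \<in> N" for u w
    by (rule adj_rtrancl_mono[of _ _ K]) (use K(1) that in \<open>auto simp: connected_graph_def\<close>)
  {
    let ?f = "\<lambda>u. if u = v then a else u"
    assume ?L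
    have "(u, w) \<in> (adj (F \<union> K))\<^sup>*" if "u \<in> V" "w \<in> V" for u w
    proof -
      have "(u, w) \<in> (adj ?E)\<^sup>*"
        using \<open>?L\<close> that by (auto simp: connected_graph_def)
      then have "(?f u, ?f w) \<in> (adj (F \<union> K))\<^sup>*"
      proof (rule rtrancl_image)
        fix x y assume "(x, y) \<in> adj ?E"
        then consider "{x, y} \<in> F" | "x = v" "y \<in> N" | "y = v" "x \<in> N"
          by (auto simp: doubleton_eq_iff)
        then show "(?f x, ?f y) \<in> (adj (F \<union> K))\<^sup>*"
        proof cases
          case 1
          with F v have "x \<noteq> v" "y \<noteq> v" by auto
          with 1 show ?thesis by auto
        qed (use a reach N v in auto)
      qed
      with that v show ?thesis by (auto split: if_splits)
    qed
    with a N show ?R by (auto simp: connected_graph_def)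
  }
  assume ?R
  have step: "(u, v) \<in> (adj ?E)\<^sup>*" "(v, u) \<in> (adj ?E)\<^sup>*" if "u \<in> N" for u
    using that by (auto simp: insert_commute intro!: r_into_rtrancl)
  have "(v, u) \<in> (adj ?E)\<^sup>*" if "u \<in> V" for u
  proof -
    have "(a, u) \<in> (adj (F \<union> K))\<^sup>*"
      using \<open>?R\<close> that a N by (auto simp: connected_graph_def)
    then have "(a, u) \<in> (adj ?E)\<^sup>*"
    proof (rule rtrancl_image[where f = "\<lambda>x. x"])
      fix x y assume "(x, y) \<in> adj (F \<union> K)"
      then show "(x, y) \<in> (adj ?E)\<^sup>*"
        using K(2)[of "{x, y}"] step by (auto intro: rtrancl_trans)
    qed
    with step(2)[OF a] show ?thesis by (rule rtrancl_trans)
  qed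
  then show ?L
    by (intro connected_graph_root[of v]) auto
qed

text \<open>The star brings \<open>card N\<close> edges and one vertex, the tree \<open>K\<close>
  brings \<open>card N - 1\<close> edges and no vertex. Hence the edge counts match when
  \<open>F\<close> and \<open>K\<close> are disjoint; if they overlap and the left side is a tree,
  the connected graph \<open>F \<union> K\<close> would have too few edges.\<close>

lemma tree_star_iff:
  assumes "finite V" and v: "v \<notin> V" and F: "simple_graph \<lparr>verts = V, edges = F\<rparr>" and N: "N \<subseteq> V"
    and K: "tree \<lparr>verts = N, edges = K\<rparr>" "simple_graph \<lparr>verts = N, edges = K\<rparr>"
  shows "tree \<lparr>verts = insert v V, edges = F \<union> (\<lambda>u. {v, u}) ` N\<rparr> \<longleftrightarrow>
    F \<inter> K = {} \<and> tree \<lparr>verts = V, edges = F \<union> K\<rparr>"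
proof -
  let ?E = "F \<union> (\<lambda>u. {v, u}) ` N"
  have finN: "finite N"
    using N \<open>finite V\<close> by (rule finite_subset)
  have fin: "finite F" "finite K"
    using \<open>finite V\<close> F K(2) finN simple_graph_finite_edges by blast+
  have cardK: "card K + 1 = card N" and connK: "connected_graph \<lparr>verts = N, edges = K\<rparr>"
    using tree_iff_card[OF finN K(2)] K(1) by auto
  have "inj_on (\<lambda>u. {v, u}) N"
    by (auto simp: inj_on_def doubleton_eq_iff)
  then have card_star: "card ?E = card F + card N"
    using F v fin finN by (subst card_Un_disjoint) (auto simp: card_image simple_graph_def)
  have E: "simple_graph \<lparr>verts = insert v V, edges = ?E\<rparr>"
    using F N v by (auto simp: simple_graph_def card_insert_if)
  have FK: "simple_graph \<lparr>verts = V, edges = F \<union> K\<rparr>"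
    using F K(2) N by (auto simp: simple_graph_def)
  have conn: "connected_graph \<lparr>verts = insert v V, edges = ?E\<rparr> \<longleftrightarrow>
      connected_graph \<lparr>verts = V, edges = F \<union> K\<rparr>" (is "_ \<longleftrightarrow> ?C")
    using F K(2) N v connK by (intro connected_graph_star_iff) (auto simp: simple_graph_def)
  show ?thesis
  proof (cases ?C)
    case True
    have "card (F \<union> K) + card (F \<inter> K) = card F + card K"
      using card_Un_Int[OF fin] by simp
    moreover have "F \<inter> K = {} \<longleftrightarrow> card (F \<inter> K) = 0"
      using fin by simp
    moreover have "card V \<le> card (F \<union> K) + 1"
      using connected_graph_card[OF \<open>finite V\<close> True FK] .
    moreover have "tree \<lparr>verts = insert v V, edges = ?E\<rparr> \<longleftrightarrow> card F + card N = card V"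
      using tree_iff_card[OF _ E] conn True card_star v \<open>finite V\<close> by simp
    moreover have "tree \<lparr>verts = V, edges = F \<union> K\<rparr> \<longleftrightarrow> card (F \<union> K) + 1 = card V"
      using tree_iff_card[OF \<open>finite V\<close> FK] True by simp
    ultimately have "tree \<lparr>verts = insert v V, edges = ?E\<rparr> \<longleftrightarrow>
        card (F \<inter> K) = 0 \<and> card (F \<union> K) + 1 = card V"
      using cardK by presburger
    with \<open>F \<inter> K = {} \<longleftrightarrow> _\<close> \<open>tree \<lparr>verts = V, edges = F \<union> K\<rparr> \<longleftrightarrow> _\<close> show ?thesis
      by (simp only:)
  qed (use conn in \<open>auto simp: tree_def\<close>)
qed

section \<open>The star-triangle relation\<close>

lemma sum_Pow_insert:
  assumes "finite A" "x \<notin> A"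
  shows "sum f (Pow (insert x A)) = sum f (Pow A) + (\<Sum>N\<in>Pow A. f (insert x N))"
proof -
  have "inj_on (insert x) (Pow A)"
    using assms(2) by (auto simp: inj_on_def)
  then show ?thesis
    unfolding Pow_insert using assms
    by (subst sum.union_disjoint) (auto simp: sum.reindex)
qed

text \<open>The trees are sorted by their intersection with \<open>D\<close>. Below,
  \<open>D\<close> consists of the three edges at the inserted vertex.\<close>

lemma spanning_tree_poly_split:
  assumes "finite (edges G)" "D \<subseteq> edges G"
  shows "spanning_tree_poly G w = (\<Sum>N\<in>Pow D. (\<Prod>e\<in>N. w e) *
    (\<Sum>F | F \<subseteq> edges G - D \<and> F \<union> N \<in> spanning_trees G. \<Prod>e\<in>F. w e))"
proof -
  have fin: "finite D" "finite {F. F \<subseteq> edges G - D \<and> F \<union> N \<in> spanning_trees G}" for N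
    using assms by (auto intro: finite_subset)
  have "(\<Sum>N\<in>Pow D. (\<Prod>e\<in>N. w e) *
      (\<Sum>F | F \<subseteq> edges G - D \<and> F \<union> N \<in> spanning_trees G. \<Prod>e\<in>F. w e)) =
    (\<Sum>(N, F)\<in>(SIGMA N:Pow D. {F. F \<subseteq> edges G - D \<and> F \<union> N \<in> spanning_trees G}).
      \<Prod>e\<in>F \<union> N. w e)"
  proof (subst sum.Sigma[symmetric])
    show "(\<Sum>N\<in>Pow D. (\<Prod>e\<in>N. w e) *
        (\<Sum>F | F \<subseteq> edges G - D \<and> F \<union> N \<in> spanning_trees G. \<Prod>e\<in>F. w e)) =
      (\<Sum>N\<in>Pow D. \<Sum>F | F \<subseteq> edges G - D \<and> F \<union> N \<in> spanning_trees G. \<Prod>e\<in>F \<union> N. w e)"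
      unfolding sum_distrib_left
    proof (intro sum.cong refl)
      fix N F assume "N \<in> Pow D" "F \<in> {F. F \<subseteq> edges G - D \<and> F \<union> N \<in> spanning_trees G}"
      then have "finite F" "finite N" "F \<inter> N = {}"
        using assms fin by (auto intro: finite_subset)
      then show "(\<Prod>e\<in>N. w e) * (\<Prod>e\<in>F. w e) = (\<Prod>e\<in>F \<union> N. w e)"
        by (simp add: prod.union_disjoint mult.commute)
    qed
  qed (use fin in auto)
  also have "\<dots> = spanning_tree_poly G w"
    unfolding spanning_tree_poly_def
    by (rule sum.reindex_bij_witness[where i = "\<lambda>T. (T \<inter> D, T - D)" and j = "\<lambda>(N, F). F \<union> N"])
      (use assms in \<open>auto simp: spanning_trees_def Un_Diff_Int\<close>)
  finally show ?thesis ..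
qed

text \<open>Each product over a tree is multiplied out, \<open>N\<close> being the set of edges
  where the summand \<open>z\<close> is chosen. Here \<open>F\<close> may still meet
  \<open>D\<close>, since the edges of \<open>D\<close> keep their old weight \<open>x\<close> as
  the other choice.\<close>

lemma spanning_tree_poly_add:
  assumes fin: "finite (edges G)" and D: "D \<subseteq> edges G"
    and z: "\<And>e. e \<in> edges G - D \<Longrightarrow> z e = 0"
  shows "spanning_tree_poly G (\<lambda>e. x e + z e) = (\<Sum>N\<in>Pow D. (\<Prod>e\<in>N. z e) *
    (\<Sum>F | F \<subseteq> edges G \<and> F \<inter> N = {} \<and> F \<union> N \<in> spanning_trees G. \<Prod>e\<in>F. x e))"
proof -
  let ?A = "\<lambda>N. {F. F \<subseteq> edges G \<and> F \<inter> N = {} \<and> F \<union> N \<in> spanning_trees G}"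
  have fins: "finite (spanning_trees G)" "finite (?A N)" for N
    using fin by (auto simp: spanning_trees_def intro: finite_subset[of _ "Pow (edges G)"])
  have finT: "finite T" if "T \<in> spanning_trees G" for T
    using fin that by (auto simp: spanning_trees_def intro: finite_subset)
  have "spanning_tree_poly G (\<lambda>e. x e + z e) =
      (\<Sum>T\<in>spanning_trees G. \<Sum>N\<in>Pow T. (\<Prod>e\<in>N. z e) * (\<Prod>e\<in>T - N. x e))"
    unfolding spanning_tree_poly_def
  proof (intro sum.cong refl)
    fix T assume "T \<in> spanning_trees G"
    then show "(\<Prod>e\<in>T. x e + z e) = (\<Sum>N\<in>Pow T. (\<Prod>e\<in>N. z e) * (\<Prod>e\<in>T - N. x e))"
      using prod_add[OF finT, of T z x] by (simp add: add.commute)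
  qed
  also have "\<dots> = (\<Sum>(T, N)\<in>Sigma (spanning_trees G) Pow. (\<Prod>e\<in>N. z e) * (\<Prod>e\<in>T - N. x e))"
    by (rule sum.Sigma) (use fins finT in auto)
  also have "\<dots> = (\<Sum>(N, F)\<in>Sigma (Pow (edges G)) ?A. (\<Prod>e\<in>N. z e) * (\<Prod>e\<in>F. x e))"
    by (rule sum.reindex_bij_witness
        [where i = "\<lambda>(N, F). (F \<union> N, N)" and j = "\<lambda>(T, N). (N, T - N)"])
      (auto simp: spanning_trees_def Un_absorb2)
  also have "\<dots> = (\<Sum>N\<in>Pow (edges G). (\<Prod>e\<in>N. z e) * (\<Sum>F\<in>?A N. \<Prod>e\<in>F. x e))"
    unfolding sum_distrib_left by (rule sum.Sigma[symmetric]) (use fin fins in auto)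
  also have "\<dots> = (\<Sum>N\<in>Pow D. (\<Prod>e\<in>N. z e) * (\<Sum>F\<in>?A N. \<Prod>e\<in>F. x e))"
  proof (rule sum.mono_neutral_right)
    show "\<forall>N\<in>Pow (edges G) - Pow D. (\<Prod>e\<in>N. z e) * (\<Sum>F\<in>?A N. \<Prod>e\<in>F. x e) = 0"
    proof
      fix N assume N: "N \<in> Pow (edges G) - Pow D"
      then obtain e where "e \<in> N" "z e = 0"
        using z by auto
      moreover have "finite N"
        using N fin by (auto intro: finite_subset)
      ultimately have "(\<Prod>e\<in>N. z e) = 0"
        by (metis prod_zero)
      then show "(\<Prod>e\<in>N. z e) * (\<Sum>F\<in>?A N. \<Prod>e\<in>F. x e) = 0" by simp
    qed
  qed (use fin D in auto)
  finally show ?thesis .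
qed

section \<open>Trees on at most three vertices and the star-triangle transformation\<close>

lemma tree_single_vertex: "tree \<lparr>verts = {a}, edges = {}\<rparr>"
  by (subst tree_iff_card) (auto simp: simple_graph_def connected_graph_def)

lemma tree_single_edge:
  assumes "a \<noteq> b"
  shows "tree \<lparr>verts = {a, b}, edges = {{a, b}}\<rparr>"
proof (subst tree_iff_card)
  show "connected_graph \<lparr>verts = {a, b}, edges = {{a, b}}\<rparr> \<and> card {{a, b}} + 1 = card {a, b}"
    using assms by (auto intro!: connected_graph_root[of a])
qed (use assms in \<open>auto simp: simple_graph_def\<close>)

lemma tree_two_edges:
  assumes "distinct [a, b, c]"
  shows "tree \<lparr>verts = {a, b, c}, edges = {{a, b}, {b, c}}\<rparr>"
proof (subst tree_iff_card)
  have "(b, u) \<in> (adj {{a, b}, {b, c}})\<^sup>*" if "u \<in> {a, b, c}" for u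
    using that by (auto simp: insert_commute)
  then have "connected_graph \<lparr>verts = {a, b, c}, edges = {{a, b}, {b, c}}\<rparr>"
    by (intro connected_graph_root[of b]) auto
  then show "connected_graph \<lparr>verts = {a, b, c}, edges = {{a, b}, {b, c}}\<rparr> \<and>
      card {{a, b}, {b, c}} + 1 = card {a, b, c}"
    using assms by (auto simp: doubleton_eq_iff)
qed (use assms in \<open>auto simp: simple_graph_def\<close>)

text \<open>In terms of electrical conductances, the star at \<open>v\<close> is replaced by an
  equivalent triangle with conductances \<open>z\<close>. Its edges are parallel to edges already
  present in \<open>E\<close>, so that the conductances add up. The proof compares coefficients by
  exchanging each star over \<open>N\<close> for a tree on \<open>N\<close>.\<close>

lemma spanning_tree_poly_star_triangle:
  fixes x :: "'v set \<Rightarrow> real"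
  assumes V: "finite V" and E: "simple_graph \<lparr>verts = V, edges = E\<rparr>"
    and abc: "distinct [a, b, c]" "{a, b, c} \<subseteq> V" "{{a, b}, {b, c}, {a, c}} \<subseteq> E"
    and v: "v \<notin> V"
    and S: "S = x {v, a} + x {v, b} + x {v, c}" "S \<noteq> 0"
    and z: "z = (\<lambda>e. if e = {a, b} then x {v, a} * x {v, b} / S
      else if e = {b, c} then x {v, b} * x {v, c} / S
      else if e = {a, c} then x {v, a} * x {v, c} / S else 0)"
  shows "spanning_tree_poly \<lparr>verts = insert v V, edges = E \<union> {{v, a}, {v, b}, {v, c}}\<rparr> x =
    S * spanning_tree_poly \<lparr>verts = V, edges = E\<rparr> (\<lambda>e. x e + z e)"
proof -
  let ?G = "\<lparr>verts = V, edges = E\<rparr>"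
  let ?H = "\<lparr>verts = insert v V, edges = E \<union> {{v, a}, {v, b}, {v, c}}\<rparr>"
  have finE: "finite E"
    using E V by (rule simple_graph_finite_edges)
  have star_E: "{v, u} \<notin> E" for u
    using E v by (auto simp: simple_graph_def)
  \<comment> \<open>These are the coefficients of the two expansions: \<open>Z K\<close> belongs to
    the choice of \<open>z\<close> exactly on \<open>K\<close>, and \<open>W N\<close> to the trees
    in which \<open>N\<close> is the neighbourhood of \<open>v\<close>.\<close>
  define Z where "Z K = (\<Sum>F | F \<subseteq> E \<and> F \<inter> K = {} \<and> F \<union> K \<in> spanning_trees ?G. \<Prod>e\<in>F. x e)" for K
  define W where "W N = (\<Sum>F | F \<subseteq> E \<and> F \<union> (\<lambda>u. {v, u}) ` N \<in> spanning_trees ?H. \<Prod>e\<in>F. x e)" for N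
  have WZ: "W N = Z K"
    if N: "N \<subseteq> {a, b, c}" and K: "tree \<lparr>verts = N, edges = K\<rparr>" "K \<subseteq> {{a, b}, {b, c}, {a, c}}" "\<Union>K \<subseteq> N"
    for N K
  proof -
    have K': "simple_graph \<lparr>verts = N, edges = K\<rparr>"
      unfolding simple_graph_def
    proof
      fix e assume "e \<in> edges \<lparr>verts = N, edges = K\<rparr>"
      then have "e \<subseteq> N" "e \<in> E"
        using K(2,3) abc(3) by auto
      with E show "e \<subseteq> verts \<lparr>verts = N, edges = K\<rparr> \<and> card e = 2"
        by (simp add: simple_graph_def)
    qed
    have "F \<union> (\<lambda>u. {v, u}) ` N \<in> spanning_trees ?H \<longleftrightarrow> F \<inter> K = {} \<and> F \<union> K \<in> spanning_trees ?G"
      if F: "F \<subseteq> E" for F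
    proof -
      have "simple_graph \<lparr>verts = V, edges = F\<rparr>"
        using E F by (auto simp: simple_graph_def)
      from tree_star_iff[OF V v this _ K(1) K'] show ?thesis
        using F N K abc(2,3) by (auto simp: spanning_trees_def)
    qed
    then show ?thesis
      unfolding W_def Z_def by (intro sum.cong) auto
  qed
  \<comment> \<open>Without a star edge the vertex \<open>v\<close> would be isolated.\<close>
  have W0: "W {} = 0"
  proof -
    have "F \<notin> spanning_trees ?H" if F: "F \<subseteq> E" for F
    proof
      assume "F \<in> spanning_trees ?H"
      then have "(v, a) \<in> (adj F)\<^sup>*"
        using abc(2) by (auto simp: spanning_trees_def tree_def connected_graph_def)
      moreover have "v \<noteq> a" using v abc by auto
      ultimately obtain u where "{v, u} \<in> F"
        by (auto elim: converse_rtranclE)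
      with F star_E show False by auto
    qed
    then have "{F. F \<subseteq> E \<and> F \<union> (\<lambda>u. {v, u}) ` {} \<in> spanning_trees ?H} = {}"
      by (simp only: image_empty Un_empty_right) blast
    then show ?thesis
      unfolding W_def by (simp only: sum.empty)
  qed
  have Z3: "Z {{a, b}, {b, c}, {a, c}} = 0"
  proof -
    have "is_cycle \<lparr>verts = V, edges = F \<union> {{a, b}, {b, c}, {a, c}}\<rparr> [a, b, c]" for F
      using abc(1) by (auto simp: is_cycle_def less_Suc_eq insert_commute)
    then have "{F. F \<subseteq> E \<and> F \<inter> {{a, b}, {b, c}, {a, c}} = {} \<and>
        F \<union> {{a, b}, {b, c}, {a, c}} \<in> spanning_trees ?G} = {}"
      by (auto simp: spanning_trees_def tree_def)
    then show ?thesis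
      unfolding Z_def by (simp only: sum.empty)
  qed
  have edges_neq: "{a, b} \<noteq> {b, c}" "{a, b} \<noteq> {a, c}" "{b, c} \<noteq> {a, c}"
    "{v, a} \<noteq> {v, b}" "{v, a} \<noteq> {v, c}" "{v, b} \<noteq> {v, c}"
    using abc(1) by (auto simp: doubleton_eq_iff)
  have "spanning_tree_poly ?G (\<lambda>e. x e + z e) =
      (\<Sum>N\<in>Pow {{a, b}, {b, c}, {a, c}}. (\<Prod>e\<in>N. z e) * Z N)"
    unfolding Z_def using finE abc(3) by (subst spanning_tree_poly_add) (auto simp: z)
  also have "\<dots> = Z {} + z {a, b} * Z {{a, b}} + z {b, c} * Z {{b, c}} + z {a, c} * Z {{a, c}}
      + z {a, b} * z {b, c} * Z {{a, b}, {b, c}} + z {b, c} * z {a, c} * Z {{b, c}, {a, c}}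
      + z {a, b} * z {a, c} * Z {{a, b}, {a, c}}"
    using edges_neq Z3 by (simp add: sum_Pow_insert)
  finally have G: "spanning_tree_poly ?G (\<lambda>e. x e + z e) = \<dots>" .
  have "spanning_tree_poly ?H x = (\<Sum>M\<in>Pow ((\<lambda>u. {v, u}) ` {a, b, c}). (\<Prod>e\<in>M. x e) *
      (\<Sum>F | F \<subseteq> E \<and> F \<union> M \<in> spanning_trees ?H. \<Prod>e\<in>F. x e))"
  proof -
    have "E \<union> {{v, a}, {v, b}, {v, c}} - (\<lambda>u. {v, u}) ` {a, b, c} = E"
      using star_E by auto
    then show ?thesis
      using spanning_tree_poly_split[of ?H "(\<lambda>u. {v, u}) ` {a, b, c}" x] finE by simp
  qed
  also have "\<dots> = x {v, a} * W {a} + x {v, b} * W {b} + x {v, c} * W {c}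
      + x {v, a} * x {v, b} * W {a, b} + x {v, b} * x {v, c} * W {b, c}
      + x {v, a} * x {v, c} * W {a, c} + x {v, a} * x {v, b} * x {v, c} * W {a, b, c}"
    using edges_neq W0 by (simp add: sum_Pow_insert W_def)
  finally have H: "spanning_tree_poly ?H x = \<dots>" .
  have "W {a} = Z {}" "W {b} = Z {}" "W {c} = Z {}"
    by (rule WZ; simp add: tree_single_vertex)+
  moreover have "W {a, b} = Z {{a, b}}" "W {b, c} = Z {{b, c}}" "W {a, c} = Z {{a, c}}"
    by (rule WZ; use abc(1) in \<open>simp add: tree_single_edge\<close>)+
  \<comment> \<open>The full star can be exchanged for any of the three two-edge paths, so these
    have equal coefficients. The three quadratic terms in \<open>z\<close> therefore combine, with
    the factor \<open>p + q + r = S\<close> cancelling one power of \<open>S\<close>.\<close>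
  moreover have "W {a, b, c} = Z {{a, b}, {b, c}}"
    by (rule WZ) (use abc(1) tree_two_edges[of a b c] in auto)
  moreover have "W {a, b, c} = Z {{b, c}, {a, c}}"
    by (rule WZ) (use abc(1) tree_two_edges[of b c a] in \<open>auto simp: insert_commute\<close>)
  moreover have "W {a, b, c} = Z {{a, b}, {a, c}}"
    by (rule WZ) (use abc(1) tree_two_edges[of b a c] in \<open>auto simp: insert_commute\<close>)
  moreover have "z {a, b} = x {v, a} * x {v, b} / S" "z {b, c} = x {v, b} * x {v, c} / S"
    "z {a, c} = x {v, a} * x {v, c} / S"
    using edges_neq by (auto simp: z)
  moreover have "S * (Z0 + p * q / S * A + q * r / S * B + p * r / S * C
      + p * q / S * (q * r / S) * D + q * r / S * (p * r / S) * D + p * q / S * (p * r / S) * D) =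
    p * Z0 + q * Z0 + r * Z0 + p * q * A + q * r * B + p * r * C + p * q * r * D"
    if "S = p + q + r" for Z0 A B C D p q r
  proof -
    have "p * q / S * (q * r / S) * D + q * r / S * (p * r / S) * D + p * q / S * (p * r / S) * D =
        p * q * r * D * (p + q + r) / (S * S)"
      using S(2) by (simp add: field_simps)
    also have "\<dots> = p * q * r * D / S"
      using S(2) that by simp
    finally show ?thesis
      using S(2) by (simp add: that[symmetric] field_simps) (simp add: that algebra_simps)
  qed
  ultimately show ?thesis
    unfolding G H using S(1) by simp
qed

section \<open>The plane Gaussian kernel\<close>

text \<open>
  By Heron's formula, \<open>4 r s - (r + s - t)\<^sup>2\<close> is 16 times the squared area of a triangle with
  squared side lengths \<open>r, s, t\<close>.
\<close>

definition heron :: "real \<Rightarrow> real \<Rightarrow> real \<Rightarrow> bool" where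
  "heron r s t \<longleftrightarrow> 0 \<le> r \<and> 0 \<le> s \<and> 0 \<le> t \<and> (r + s - t)\<^sup>2 \<le> 4 * r * s"

lemma heron_commute: "heron r s t \<Longrightarrow> heron s r t" "heron r s t \<Longrightarrow> heron r t s"
  by (auto simp: heron_def power2_eq_square algebra_simps)

text \<open>This is the Cauchy-Schwarz inequality for the two side vectors at \<open>x\<close>, by
  the law of cosines.\<close>

lemma heron_dist:
  fixes x y z :: "'a :: real_inner"
  shows "heron ((dist x y)\<^sup>2) ((dist x z)\<^sup>2) ((dist y z)\<^sup>2)"
proof -
  have "(dist x y)\<^sup>2 + (dist x z)\<^sup>2 - (dist y z)\<^sup>2 = 2 * inner (y - x) (z - x)"
    by (simp add: dist_norm power2_norm_eq_inner algebra_simps inner_commute)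
  moreover have "(inner (y - x) (z - x))\<^sup>2 \<le> (dist x y)\<^sup>2 * (dist x z)\<^sup>2"
    using Cauchy_Schwarz_ineq[of "y - x" "z - x"]
    by (simp add: dist_norm power2_norm_eq_inner[symmetric] norm_minus_commute)
  ultimately show ?thesis
    by (simp add: heron_def power_mult_distrib)
qed

text \<open>Here \<open>snd w\<close> is a squared height.\<close>

definition elevated_dist :: "real \<Rightarrow> real \<Rightarrow> (real \<times> real) \<times> real \<Rightarrow> real" where
  "elevated_dist a1 a2 w = (fst (fst w) - a1)\<^sup>2 + (snd (fst w) - a2)\<^sup>2 + snd w"

lemma elevated_dist_nonneg: "0 \<le> snd w \<Longrightarrow> 0 \<le> elevated_dist a1 a2 w"
  by (simp add: elevated_dist_def)

text \<open>The three numbers are squared distances in three-space between two points of the plane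
  and a point at height \<open>sqrt (snd w)\<close>.\<close>

lemma heron_elevated:
  assumes "0 \<le> snd w"
  shows "heron ((a1 - b1)\<^sup>2 + (a2 - b2)\<^sup>2) (elevated_dist a1 a2 w) (elevated_dist b1 b2 w)"
  using heron_dist[of "(a1, a2, 0::real)" "(b1, b2, 0)" "(fst (fst w), snd (fst w), sqrt (snd w))"] assms
  by (simp add: dist_Pair_Pair dist_real_def power2_commute add.assoc elevated_dist_def)

text \<open>
  The triangle with squared side lengths \<open>r, s, t\<close> is placed with its base at \<open>(0, 0)\<close> and
  \<open>(sqrt r, 0)\<close>. If \<open>r = 0\<close>, then \<open>s = t\<close> and the division by zero puts the apex at \<open>(0, sqrt s)\<close>.
\<close>

definition apex_x :: "real \<Rightarrow> real \<Rightarrow> real \<Rightarrow> real" where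
  "apex_x r s t = (r + s - t) / (2 * sqrt r)"

definition apex_y :: "real \<Rightarrow> real \<Rightarrow> real \<Rightarrow> real" where
  "apex_y r s t = sqrt (s - (apex_x r s t)\<^sup>2)"


text \<open>Heron's inequality makes the radicand of \<open>apex_y\<close> nonnegative, so the
  placed triangle has the prescribed squared sides.\<close>

lemma heron_apex:
  assumes "heron r s t"
  shows "(sqrt r)\<^sup>2 = r" "(apex_x r s t)\<^sup>2 + (apex_y r s t)\<^sup>2 = s"
    "(apex_x r s t - sqrt r)\<^sup>2 + (apex_y r s t)\<^sup>2 = t"
proof -
  note h = assms[unfolded heron_def]
  show r: "(sqrt r)\<^sup>2 = r"
    using h by simp
  have "(apex_x r s t)\<^sup>2 \<le> s"
  proof (cases "r = 0")
    case False
    with h have "(apex_x r s t)\<^sup>2 = (r + s - t)\<^sup>2 / (4 * r)"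
      by (simp add: apex_x_def power_divide power_mult_distrib)
    also have "\<dots> \<le> s"
      using h False by (simp add: divide_le_eq mult_ac)
    finally show ?thesis .
  qed (use h in \<open>simp add: apex_x_def\<close>)
  then show s: "(apex_x r s t)\<^sup>2 + (apex_y r s t)\<^sup>2 = s"
    by (simp add: apex_y_def)
  \<comment> \<open>For \<open>r = 0\<close> both sides vanish, because \<open>heron\<close> then
    forces \<open>s = t\<close>.\<close>
  have "2 * apex_x r s t * sqrt r = r + s - t"
    using h by (cases "r = 0") (auto simp: apex_x_def)
  with r s show "(apex_x r s t - sqrt r)\<^sup>2 + (apex_y r s t)\<^sup>2 = t"
    by (simp add: power2_diff)
qed

section \<open>Product measures and the Gauss-Gamma kernel\<close>

lemma AE_pair_measure_fst:
  assumes "sigma_finite_measure K" and "AE x in M. P x"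
  shows "AE z in M \<Otimes>\<^sub>M K. P (fst z)"
proof -
  interpret K: sigma_finite_measure K by fact
  obtain N where N: "{x \<in> space M. \<not> P x} \<subseteq> N" "emeasure M N = 0" "N \<in> sets M"
    using assms(2) by (auto elim: AE_E)
  show ?thesis
  proof (rule AE_I)
    show "{z \<in> space (M \<Otimes>\<^sub>M K). \<not> P (fst z)} \<subseteq> N \<times> space K"
      using N by (auto simp: space_pair_measure)
    show "emeasure (M \<Otimes>\<^sub>M K) (N \<times> space K) = 0"
      using N by (simp add: K.emeasure_pair_measure_Times)
  qed (use N in auto)
qed

lemma AE_pair_measure_snd:
  assumes "sigma_finite_measure K" and "AE y in K. P y" 
  shows "AE z in M \<Otimes>\<^sub>M K. P (snd z)"
proof -
  interpret K: sigma_finite_measure K by fact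
  obtain N where N: "{y \<in> space K. \<not> P y} \<subseteq> N" "emeasure K N = 0" "N \<in> sets K"
    using assms(2) by (auto elim: AE_E)
  show ?thesis
  proof (rule AE_I)
    show "{z \<in> space (M \<Otimes>\<^sub>M K). \<not> P (snd z)} \<subseteq> space M \<times> N"
      using N by (auto simp: space_pair_measure)
    show "emeasure (M \<Otimes>\<^sub>M K) (space M \<times> N) = 0"
      using N by (simp add: K.emeasure_pair_measure_Times)
  qed (use N in auto)
qed

text \<open>The Gamma density with its exponential factor removed, which leaves an infinite measure
  whose Laplace transform at \<open>S\<close> is the pure power \<open>S powr - k\<close>.\<close>

definition gamma_measure :: "real \<Rightarrow> real measure" where
  "gamma_measure k = density lborel (\<lambda>s. ennreal (indicator {0..} s * s powr (k - 1) / Gamma k))"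

lemma sets_gamma_measure [measurable_cong, simp]: "sets (gamma_measure k) = sets borel"
  and space_gamma_measure [simp]: "space (gamma_measure k) = UNIV"
  by (simp_all add: gamma_measure_def)

lemma sigma_finite_gamma_measure: "sigma_finite_measure (gamma_measure k)"
  unfolding gamma_measure_def by (subst sigma_finite_measure.sigma_finite_iff_density_finite[OF sigma_finite_lborel]) auto

lemma AE_gamma_measure: "AE s in gamma_measure k. 0 \<le> s"
  unfolding gamma_measure_def by (subst AE_density) (auto simp: indicator_def)

text \<open>Substitution of \<open>S * t\<close> for \<open>t\<close> in Euler's integral for
  \<open>Gamma k\<close>.\<close>

lemma nn_integral_gamma_measure:
  assumes "0 < k" "0 < S"
  shows "(\<integral>\<^sup>+s. ennreal (exp (- (S * s))) \<partial>gamma_measure k) = ennreal (S powr - k)"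
proof -
  have G: "0 < Gamma k"
    using assms by (simp add: Gamma_real_pos)
  have "ennreal (Gamma k) = (\<integral>\<^sup>+t. ennreal (indicator {0..} t * t powr (k - 1) / exp t) \<partial>lborel)"
    using assms by (simp add: Gamma_conv_nn_integral_real)
  also have "\<dots> = ennreal S *
      (\<integral>\<^sup>+t. ennreal (indicator {0..} (S * t) * (S * t) powr (k - 1) / exp (S * t)) \<partial>lborel)"
    using assms by (subst nn_integral_real_affine[where c = S and t = 0]) auto
  also have "\<dots> = ennreal S * (\<integral>\<^sup>+t. ennreal (S powr (k - 1) * Gamma k) *
      (ennreal (indicator {0..} t * t powr (k - 1) / Gamma k) * ennreal (exp (- (S * t)))) \<partial>lborel)"
    using assms G
    by (intro arg_cong2[where f = "(*)"] refl nn_integral_cong)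
      (auto simp: ennreal_mult'[symmetric] powr_mult exp_minus field_simps zero_le_mult_iff
        less_imp_neq[symmetric] split: split_indicator)
  also have "\<dots> = ennreal (S powr k * Gamma k) * (\<integral>\<^sup>+s. ennreal (exp (- (S * s))) \<partial>gamma_measure k)"
    using assms G unfolding gamma_measure_def
    by (subst nn_integral_cmult, measurable)
      (auto simp: nn_integral_density mult.assoc[symmetric] ennreal_mult'[symmetric]
        powr_diff)
  finally have eq: "ennreal (Gamma k) = ennreal (S powr k * Gamma k) * (\<integral>\<^sup>+s. ennreal (exp (- (S * s))) \<partial>gamma_measure k)" .
  have "ennreal (S powr - k) = ennreal (S powr - k / Gamma k) * ennreal (Gamma k)"
    using G by (simp add: ennreal_mult'[symmetric])
  also have "\<dots> = ennreal (S powr - k / Gamma k * (S powr k * Gamma k)) *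
      (\<integral>\<^sup>+s. ennreal (exp (- (S * s))) \<partial>gamma_measure k)"
    using G by (subst eq) (simp add: mult.assoc[symmetric] ennreal_mult'[symmetric])
  also have "S powr - k / Gamma k * (S powr k * Gamma k) = 1"
    using less_imp_neq[OF G] assms by (simp add: powr_minus)
  finally show ?thesis by simp
qed

text \<open>Lebesgue measure, scaled so that \<open>exp (- (S * p\<^sup>2))\<close> has integral
  \<open>S powr - (1 / 2)\<close> without a constant.\<close>

definition gauss_line :: "real measure" where
  "gauss_line = density lborel (\<lambda>_. ennreal (1 / sqrt pi))"

lemma sets_gauss_line [measurable_cong, simp]: "sets gauss_line = sets borel"
  and space_gauss_line [simp]: "space gauss_line = UNIV"
  by (simp_all add: gauss_line_def)

lemma sigma_finite_gauss_line: "sigma_finite_measure gauss_line"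
  unfolding gauss_line_def by (subst sigma_finite_measure.sigma_finite_iff_density_finite[OF sigma_finite_lborel]) auto

text \<open>The square is completed at the weighted mean \<open>m\<close> of \<open>a\<close>,
  \<open>b\<close>, \<open>c\<close>. What remains is the weighted sum of their pairwise squared
  distances, divided by \<open>S\<close>, and a normal density with standard deviation
  \<open>1 / sqrt (2 * S)\<close>.\<close>

lemma nn_integral_gauss_line:
  assumes S: "S = x + y + z" "0 < S"
  shows "(\<integral>\<^sup>+p. ennreal (exp (- (x * (p - a)\<^sup>2 + y * (p - b)\<^sup>2 + z * (p - c)\<^sup>2))) \<partial>gauss_line) =
    ennreal (S powr - (1 / 2) * exp (- (x * y * (a - b)\<^sup>2 + y * z * (b - c)\<^sup>2 + x * z * (a - c)\<^sup>2) / S))"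
    (is "?L = ennreal (_ * ?E)")
proof -
  define m where "m = (x * a + y * b + z * c) / S"
  have sq: "x * (p - a)\<^sup>2 + y * (p - b)\<^sup>2 + z * (p - c)\<^sup>2 =
      S * (p - m)\<^sup>2 + (x * y * (a - b)\<^sup>2 + y * z * (b - c)\<^sup>2 + x * z * (a - c)\<^sup>2) / S" for p
  proof -
    have "S * m = x * a + y * b + z * c"
      using S(2) by (simp add: m_def)
    then have "S * (x * (p - a)\<^sup>2 + y * (p - b)\<^sup>2 + z * (p - c)\<^sup>2) =
        S * (S * (p - m)\<^sup>2) + (x * y * (a - b)\<^sup>2 + y * z * (b - c)\<^sup>2 + x * z * (a - c)\<^sup>2)"
      unfolding S(1) by algebra
    then show ?thesis
      using S(2) by (simp add: field_simps)
  qed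
  have "1 / sqrt pi * exp (- (x * (p - a)\<^sup>2 + y * (p - b)\<^sup>2 + z * (p - c)\<^sup>2)) =
      S powr - (1 / 2) * ?E * normal_density m (1 / sqrt (2 * S)) p" for p
    using S(2) unfolding sq normal_density_def minus_add_distrib exp_add minus_divide_left
    by (simp add: power_divide powr_minus powr_half_sqrt real_sqrt_divide
        divide_simps real_sqrt_mult)
  then have "?L = (\<integral>\<^sup>+p. ennreal (S powr - (1 / 2) * ?E) *
      ennreal (normal_density m (1 / sqrt (2 * S)) p) \<partial>lborel)"
    unfolding gauss_line_def
    by (subst nn_integral_density) (auto simp: ennreal_mult'[symmetric] intro!: nn_integral_cong)
  also have "\<dots> = ennreal (S powr - (1 / 2) * ?E)"
    using S(2) by (subst nn_integral_cmult) (auto simp: nn_integral_eq_integral)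
  finally show ?thesis .
qed

definition kernel_measure :: "real \<Rightarrow> ((real \<times> real) \<times> real) measure" where
  "kernel_measure k = (gauss_line \<Otimes>\<^sub>M gauss_line) \<Otimes>\<^sub>M gamma_measure k"

lemma sets_kernel_measure [measurable_cong, simp]:
    "sets (kernel_measure k) = sets ((borel \<Otimes>\<^sub>M borel) \<Otimes>\<^sub>M borel)"
  and space_kernel_measure [simp]: "space (kernel_measure k) = UNIV"
  by (auto simp: kernel_measure_def space_pair_measure intro!: sets_pair_measure_cong)

lemma sigma_finite_kernel_measure: "sigma_finite_measure (kernel_measure k)"
proof -
  interpret L: pair_sigma_finite gauss_line gauss_line
    by (intro pair_sigma_finite.intro sigma_finite_gauss_line)
  interpret K: pair_sigma_finite "gauss_line \<Otimes>\<^sub>M gauss_line" "gamma_measure k"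
    by (intro pair_sigma_finite.intro L.sigma_finite_measure_axioms sigma_finite_gamma_measure)
  show ?thesis
    unfolding kernel_measure_def by (rule K.sigma_finite_measure_axioms)
qed

lemma AE_kernel_measure: "AE w in kernel_measure k. 0 \<le> snd w"
  unfolding kernel_measure_def
  by (rule AE_pair_measure_snd[OF sigma_finite_gamma_measure AE_gamma_measure])

text \<open>The exponent separates into the two plane coordinates and the squared height. Each
  coordinate contributes \<open>S powr - (1 / 2)\<close> and the height \<open>S powr - k\<close>.
  Positivity is asked of the sum \<open>S\<close>, so that the base triangle can use a weight
  0.\<close>

lemma nn_integral_kernel_measure:
  assumes S: "S = x + y + z" "0 < S" and k: "0 < k"
  shows "(\<integral>\<^sup>+w. ennreal (exp (- (x * elevated_dist a1 a2 w + y * elevated_dist b1 b2 w + z * elevated_dist c1 c2 w))) \<partial>kernel_measure k) =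
    ennreal (S powr - (k + 1) * exp (- (x * y * ((a1 - b1)\<^sup>2 + (a2 - b2)\<^sup>2)
      + y * z * ((b1 - c1)\<^sup>2 + (b2 - c2)\<^sup>2) + x * z * ((a1 - c1)\<^sup>2 + (a2 - c2)\<^sup>2)) / S))"
proof -
  interpret L: sigma_finite_measure gauss_line by (rule sigma_finite_gauss_line)
  interpret G: sigma_finite_measure "gamma_measure k" by (rule sigma_finite_gamma_measure)
  define P where "P p = ennreal (exp (- (x * (p - a1)\<^sup>2 + y * (p - b1)\<^sup>2 + z * (p - c1)\<^sup>2)))" for p
  define Q where "Q q = ennreal (exp (- (x * (q - a2)\<^sup>2 + y * (q - b2)\<^sup>2 + z * (q - c2)\<^sup>2)))" for q
  define R where "R s = ennreal (exp (- (S * s)))" for s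
  have [measurable]: "P \<in> borel_measurable borel" "Q \<in> borel_measurable borel" "R \<in> borel_measurable borel"
    unfolding P_def Q_def R_def by measurable
  have "ennreal (exp (- (x * elevated_dist a1 a2 w + y * elevated_dist b1 b2 w + z * elevated_dist c1 c2 w))) =
      P (fst (fst w)) * Q (snd (fst w)) * R (snd w)" for w
    unfolding P_def Q_def R_def S(1) elevated_dist_def
    by (simp add: ennreal_mult'[symmetric] exp_add[symmetric] algebra_simps)
  then have "?thesis \<longleftrightarrow> (\<integral>\<^sup>+w. P (fst (fst w)) * Q (snd (fst w)) * R (snd w) \<partial>kernel_measure k) =
    ennreal (S powr - (k + 1) * exp (- (x * y * ((a1 - b1)\<^sup>2 + (a2 - b2)\<^sup>2)
      + y * z * ((b1 - c1)\<^sup>2 + (b2 - c2)\<^sup>2) + x * z * ((a1 - c1)\<^sup>2 + (a2 - c2)\<^sup>2)) / S))"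
    by simp
  moreover have "(\<integral>\<^sup>+w. P (fst (fst w)) * Q (snd (fst w)) * R (snd w) \<partial>kernel_measure k) =
      (\<integral>\<^sup>+u. \<integral>\<^sup>+s. P (fst u) * Q (snd u) * R s \<partial>gamma_measure k \<partial>(gauss_line \<Otimes>\<^sub>M gauss_line))"
    unfolding kernel_measure_def by (subst G.nn_integral_fst[symmetric]) auto
  moreover have "\<dots> = (\<integral>\<^sup>+u. P (fst u) * Q (snd u) \<partial>(gauss_line \<Otimes>\<^sub>M gauss_line)) * (\<integral>\<^sup>+s. R s \<partial>gamma_measure k)"
    by (simp add: nn_integral_cmult nn_integral_multc)
  moreover have "(\<integral>\<^sup>+u. P (fst u) * Q (snd u) \<partial>(gauss_line \<Otimes>\<^sub>M gauss_line)) =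
      (\<integral>\<^sup>+p. P p \<partial>gauss_line) * (\<integral>\<^sup>+q. Q q \<partial>gauss_line)"
    by (subst L.nn_integral_fst[symmetric]) (auto simp: nn_integral_cmult nn_integral_multc)
  moreover have "(\<integral>\<^sup>+s. R s \<partial>gamma_measure k) = ennreal (S powr - k)"
    unfolding R_def using nn_integral_gamma_measure[OF k S(2)] .
  moreover have "S powr - (k + 1) = S powr - (1 / 2) * S powr - (1 / 2) * S powr - k"
    using S(2) by (simp only: powr_add[symmetric]) (simp add: algebra_simps)
  ultimately show ?thesis
    unfolding P_def Q_def nn_integral_gauss_line[OF S]
    by (simp add: ennreal_mult'[symmetric] mult_ac exp_add[symmetric] add_divide_distrib[symmetric]
        diff_divide_distrib[symmetric] algebra_simps)
qed

text \<open>The plane takes one unit of the exponent, so the Gamma factor has parameter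
  \<open>k - 1\<close>, which must be positive. The product of two weights is paired with the side
  between their foot points: \<open>x * y\<close> with \<open>r\<close>, \<open>y * z\<close> with
  \<open>t\<close>, \<open>x * z\<close> with \<open>s\<close>.\<close>

lemma nn_integral_kernel_heron:
  assumes S: "S = x + y + z" "0 < S" and k: "1 < k" and h: "heron r s t"
  shows "(\<integral>\<^sup>+w. ennreal (exp (- (x * elevated_dist 0 0 w + y * elevated_dist (sqrt r) 0 w
      + z * elevated_dist (apex_x r s t) (apex_y r s t) w))) \<partial>kernel_measure (k - 1)) =
    ennreal (S powr - k * exp (- (x * y * r + y * z * t + x * z * s) / S))"
  using nn_integral_kernel_measure[OF S, of "k - 1" 0 0 "sqrt r" 0 "apex_x r s t" "apex_y r s t"]
    k heron_apex[OF h]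
  by (simp add: power2_commute[of "sqrt r"])

text \<open>Each new face spans one side of the placed triangle and the elevated point.\<close>

lemma heron_face:
  assumes "0 \<le> snd w" and h: "heron r s t"
  shows "heron (elevated_dist 0 0 w) (elevated_dist (sqrt r) 0 w) r"
    "heron (elevated_dist 0 0 w) (elevated_dist (apex_x r s t) (apex_y r s t) w) s"
    "heron (elevated_dist (sqrt r) 0 w) (elevated_dist (apex_x r s t) (apex_y r s t) w) t"
  using heron_elevated[OF assms(1), of 0 "sqrt r" 0 0]
    heron_elevated[OF assms(1), of 0 "apex_x r s t" 0 "apex_y r s t"]
    heron_elevated[OF assms(1), of "sqrt r" "apex_x r s t" 0 "apex_y r s t"] heron_apex[OF h]
  by (auto simp: power2_commute[of "sqrt r"] dest: heron_commute)

section \<open>Smoothness and alternating differences\<close>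

lemma open_orthant_upd: "x \<in> open_orthant I \<Longrightarrow> i \<in> I \<Longrightarrow> 0 < t \<Longrightarrow> x(i := t) \<in> open_orthant I"
  by (auto simp: open_orthant_def PiE_def extensional_def)

lemma open_orthant_pos: "x \<in> open_orthant I \<Longrightarrow> i \<in> I \<Longrightarrow> 0 < x i"
  by (auto simp: open_orthant_def)

lemma open_orthant_add: "x \<in> open_orthant I \<Longrightarrow> i \<in> I \<Longrightarrow> 0 < h \<Longrightarrow> x(i := x i + h) \<in> open_orthant I"
  by (simp add: open_orthant_upd open_orthant_pos add_pos_pos del: fun_upd_apply)

section \<open>Polynomial functions and smoothness of their real powers\<close>

inductive_set poly_functions :: "(('i \<Rightarrow> real) \<Rightarrow> real) set" where
  const: "(\<lambda>_. c) \<in> poly_functions"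
| var: "(\<lambda>x. x i) \<in> poly_functions"
| add: "p \<in> poly_functions \<Longrightarrow> q \<in> poly_functions \<Longrightarrow> (\<lambda>x. p x + q x) \<in> poly_functions"
| mult: "p \<in> poly_functions \<Longrightarrow> q \<in> poly_functions \<Longrightarrow> (\<lambda>x. p x * q x) \<in> poly_functions"

lemma poly_functions_sum: "(\<And>a. a \<in> A \<Longrightarrow> p a \<in> poly_functions) \<Longrightarrow> (\<lambda>x. \<Sum>a\<in>A. p a x) \<in> poly_functions"
  by (induction A rule: infinite_finite_induct) (auto intro: poly_functions.intros)

lemma poly_functions_prod: "(\<And>a. a \<in> A \<Longrightarrow> p a \<in> poly_functions) \<Longrightarrow> (\<lambda>x. \<Prod>a\<in>A. p a x) \<in> poly_functions"
  by (induction A rule: infinite_finite_induct) (auto intro: poly_functions.intros)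

lemma poly_functions_continuous: "p \<in> poly_functions \<Longrightarrow> continuous_on A p"
  by (induction rule: poly_functions.induct)
    (auto intro!: continuous_intros continuous_on_subset[OF continuous_on_product_coordinates])

lemma poly_functions_derivative:
  assumes "p \<in> poly_functions"
  shows "\<exists>p'\<in>poly_functions. \<forall>x t. ((\<lambda>t. p (x(i := t))) has_real_derivative p' (x(i := t))) (at t)"
  using assms
proof induction
  case (const c)
  show ?case
    by (rule bexI[of _ "\<lambda>_. 0"]) (auto intro: poly_functions.const)
next
  case (var j)
  show ?case
    by (rule bexI[of _ "\<lambda>_. if j = i then 1 else 0"])
      (auto intro: poly_functions.const)
next
  case (add p q)
  then obtain p' q' where "p' \<in> poly_functions" "q' \<in> poly_functions"
    "\<And>x t. ((\<lambda>t. p (x(i := t))) has_real_derivative p' (x(i := t))) (at t)"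
    "\<And>x t. ((\<lambda>t. q (x(i := t))) has_real_derivative q' (x(i := t))) (at t)"
    by blast
  then show ?case
    by (intro bexI[of _ "\<lambda>x. p' x + q' x"])
      (auto intro: poly_functions.add DERIV_add simp del: fun_upd_apply)
next
  case (mult p q)
  then obtain p' q' where "p' \<in> poly_functions" "q' \<in> poly_functions"
    "\<And>x t. ((\<lambda>t. p (x(i := t))) has_real_derivative p' (x(i := t))) (at t)"
    "\<And>x t. ((\<lambda>t. q (x(i := t))) has_real_derivative q' (x(i := t))) (at t)"
    by blast
  with mult.hyps show ?case
    by (intro bexI[of _ "\<lambda>x. p' x * q x + q' x * p x"])
      (auto intro: poly_functions.intros DERIV_mult simp del: fun_upd_apply)
qed

text \<open>Functions of the form \<open>p x * q x powr c\<close> are closed under partial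
  derivatives, each of which lowers the exponent by one.\<close>

lemma poly_powr_partial_deriv:
  assumes q: "q \<in> poly_functions" "\<And>x. x \<in> open_orthant I \<Longrightarrow> 0 < q x"
    and p: "p \<in> poly_functions" and g: "\<And>x. x \<in> open_orthant I \<Longrightarrow> g x = p x * q x powr c" and i: "i \<in> I"
  obtains p' where "p' \<in> poly_functions"
    "\<And>x. x \<in> open_orthant I \<Longrightarrow>
      ((\<lambda>t. g (x(i := t))) has_real_derivative p' x * q x powr (c - 1)) (at (x i))"
proof -
  obtain dp dq where dp: "dp \<in> poly_functions"
      "\<And>x t. ((\<lambda>t. p (x(i := t))) has_real_derivative dp (x(i := t))) (at t)"
    and dq: "dq \<in> poly_functions"
      "\<And>x t. ((\<lambda>t. q (x(i := t))) has_real_derivative dq (x(i := t))) (at t)"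
    using poly_functions_derivative[OF p, of i] poly_functions_derivative[OF q(1), of i] by blast
  show thesis
  proof (rule that[of "\<lambda>x. dp x * q x + c * (p x * dq x)"])
    show "(\<lambda>x. dp x * q x + c * (p x * dq x)) \<in> poly_functions"
      using p q dp dq by (intro poly_functions.intros)
    fix x assume x: "x \<in> open_orthant I"
    have "((\<lambda>t. q (x(i := t))) has_real_derivative dq x) (at (x i))"
      using dq(2)[of x "x i"] by simp
    moreover have "((\<lambda>t. p (x(i := t))) has_real_derivative dp x) (at (x i))"
      using dp(2)[of x "x i"] by simp
    ultimately have "((\<lambda>t. p (x(i := t)) * q (x(i := t)) powr c) has_real_derivative
        dp x * q x powr c + (c * q x powr (c - 1) * dq x) * p x) (at (x i))"
      using q(2)[OF x] by (auto intro!: derivative_eq_intros simp: powr_diff)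
    also have "dp x * q x powr c + (c * q x powr (c - 1) * dq x) * p x =
        (dp x * q x + c * (p x * dq x)) * q x powr (c - 1)"
      using q(2)[OF x] by (simp add: powr_diff field_simps)
    finally show "((\<lambda>t. g (x(i := t))) has_real_derivative
        (dp x * q x + c * (p x * dq x)) * q x powr (c - 1)) (at (x i))"
    \<comment> \<open>The formula for \<open>g\<close> holds on the orthant alone, hence for
      \<open>t > 0\<close>, which is an open neighbourhood of \<open>x i\<close>.\<close>
    proof (rule has_field_derivative_transform_within_open[where S = "{0<..}"])
      show "p (x(i := t)) * q (x(i := t)) powr c = g (x(i := t))" if "t \<in> {0<..}" for t
        using g[OF open_orthant_upd[OF x i]] that by simp
    qed (use open_orthant_pos[OF x i] in auto)
  qed
qed

lemma smooth_on_orthant_poly_powr: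
  assumes q: "q \<in> poly_functions" "\<And>x. x \<in> open_orthant I \<Longrightarrow> 0 < q x"
  shows "smooth_on_orthant I (\<lambda>x. q x powr c)"
proof -
  have rep: "\<exists>p\<in>poly_functions. \<exists>c'. \<forall>x\<in>open_orthant I.
      iterated_partial_deriv es (\<lambda>x. q x powr c) x = p x * q x powr c'" if "es \<in> lists I" for es
    using that
  proof (induction es)
    case Nil
    show ?case
      by (rule bexI[of _ "\<lambda>_. 1"])
        (auto simp: iterated_partial_deriv_def intro: poly_functions.const)
  next
    case (Cons i es)
    then obtain p c' where p: "p \<in> poly_functions"
      "\<And>x. x \<in> open_orthant I \<Longrightarrow> iterated_partial_deriv es (\<lambda>x. q x powr c) x = p x * q x powr c'"
      by auto
    obtain p' where "p' \<in> poly_functions" "\<And>x. x \<in> open_orthant I \<Longrightarrow>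
        ((\<lambda>t. iterated_partial_deriv es (\<lambda>x. q x powr c) (x(i := t))) has_real_derivative
          p' x * q x powr (c' - 1)) (at (x i))"
      using poly_powr_partial_deriv[OF q p, of I i] Cons.hyps by blast
    then show ?case
      by (intro bexI[of _ p'] exI[of _ "c' - 1"])
        (auto simp: iterated_partial_deriv_def partial_deriv_def intro: DERIV_imp_deriv)
  qed
  show ?thesis
    unfolding smooth_on_orthant_def
  proof (intro ballI conjI)
    fix es assume "es \<in> lists I"
    then obtain p c' where p: "p \<in> poly_functions"
      "\<And>x. x \<in> open_orthant I \<Longrightarrow> iterated_partial_deriv es (\<lambda>x. q x powr c) x = p x * q x powr c'"
      using rep by blast
    have "continuous_on (open_orthant I) (\<lambda>x. p x * q x powr c')"
      by (intro continuous_on_mult continuous_on_powr continuous_on_const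
          poly_functions_continuous p(1) q(1)) (auto dest: q(2))
    then show "continuous_on (open_orthant I) (iterated_partial_deriv es (\<lambda>x. q x powr c))"
      by (rule continuous_on_eq) (simp add: p(2))
    fix i x assume i: "i \<in> I" and x: "x \<in> open_orthant I"
    show "(\<lambda>t. iterated_partial_deriv es (\<lambda>x. q x powr c) (x(i := t))) differentiable at (x i)"
      by (rule poly_powr_partial_deriv[OF q p i]) (use x in \<open>auto simp: real_differentiable_def simp del: fun_upd_apply\<close>)
  qed
qed

section \<open>Alternating finite differences\<close>

definition neg_difference :: "'i \<times> real \<Rightarrow> (('i \<Rightarrow> real) \<Rightarrow> real) \<Rightarrow> ('i \<Rightarrow> real) \<Rightarrow> real" where
  "neg_difference = (\<lambda>(i, h) f x. f x - f (x(i := x i + h)))"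

lemma neg_difference_apply: "neg_difference (i, h) f x = f x - f (x(i := x i + h))"
  by (simp add: neg_difference_def)

text \<open>The derivative-free form of complete monotonicity. The alternating sign is built into
  \<open>neg_difference\<close>, and positive steps never leave the orthant.\<close>

definition alternating_differences :: "'i set \<Rightarrow> (('i \<Rightarrow> real) \<Rightarrow> real) \<Rightarrow> bool" where
  "alternating_differences I f \<longleftrightarrow>
    (\<forall>ihs\<in>lists (I \<times> {0<..}). \<forall>x\<in>open_orthant I. 0 \<le> foldr neg_difference ihs f x)"

lemma foldr_neg_difference_cong:
  assumes "ihs \<in> lists (I \<times> {0::real<..})" and "\<And>x. x \<in> open_orthant I \<Longrightarrow> f x = g x" and "x \<in> open_orthant I"
  shows "foldr neg_difference ihs f x = foldr neg_difference ihs g x"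
  using assms(1,3)
proof (induction ihs arbitrary: x)
  case (Cons ih ihs)
  then show ?case
    by (cases ih) (auto simp: neg_difference_apply open_orthant_add simp del: fun_upd_apply)
qed (use assms(2) in simp)

text \<open>An iterated difference is a combination of finitely many values, so pointwise
  convergence suffices.\<close>

lemma foldr_neg_difference_tendsto:
  assumes "ihs \<in> lists (I \<times> {0::real<..})"
    and "\<And>x. x \<in> open_orthant I \<Longrightarrow> (\<lambda>n. g n x) \<longlonglongrightarrow> f x" and "x \<in> open_orthant I"
  shows "(\<lambda>n. foldr neg_difference ihs (g n) x) \<longlonglongrightarrow> foldr neg_difference ihs f x"
  using assms(1,3)
proof (induction ihs arbitrary: x)
  case (Cons ih ihs)
  then show ?case
    by (cases ih) (auto simp: neg_difference_apply intro!: tendsto_diff Cons.IH open_orthant_add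
        simp del: fun_upd_apply)
qed (use assms(2) in simp)

lemma foldr_neg_difference_scale:
  "foldr neg_difference ihs (\<lambda>x. c * f x) x = c * foldr neg_difference ihs f x"
proof (induction ihs arbitrary: x)
  case (Cons ih ihs)
  then show ?case
    by (cases ih) (simp add: neg_difference_apply right_diff_distrib del: fun_upd_apply)
qed simp

text \<open>The function \<open>- partial_deriv i f\<close> is the pointwise limit of the quotients
  \<open>g n\<close> of one further difference with step \<open>1 / real (Suc n)\<close>.\<close>

lemma alternating_differences_partial_deriv:
  assumes f: "alternating_differences I f" and i: "i \<in> I"
    and diff: "\<And>x. x \<in> open_orthant I \<Longrightarrow> (\<lambda>t. f (x(i := t))) differentiable (at (x i))"
  shows "alternating_differences I (\<lambda>x. - partial_deriv i f x)"
  unfolding alternating_differences_def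
proof (intro ballI)
  fix ihs x assume ihs: "ihs \<in> lists (I \<times> {0::real<..})" and x: "x \<in> open_orthant I"
  define g where "g n = (\<lambda>x. real (Suc n) * neg_difference (i, 1 / real (Suc n)) f x)" for n
  have lim: "(\<lambda>n. g n x) \<longlonglongrightarrow> - partial_deriv i f x" if x: "x \<in> open_orthant I" for x
  proof -
    have "((\<lambda>t. f (x(i := t))) has_real_derivative partial_deriv i f x) (at (x i))"
      using diff[OF x] unfolding partial_deriv_def
      by (metis DERIV_deriv_iff_real_differentiable)
    then have "((\<lambda>h. (f (x(i := x i + h)) - f x) / h) \<longlongrightarrow> partial_deriv i f x) (at 0)"
      by (simp add: DERIV_def)
    moreover have "filterlim (\<lambda>n. 1 / real (Suc n)) (at 0) sequentially"
      by (rule filterlim_atI) (use LIMSEQ_inverse_real_of_nat in \<open>auto simp: inverse_eq_divide\<close>)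
    ultimately have "(\<lambda>n. (f (x(i := x i + 1 / real (Suc n))) - f x) / (1 / real (Suc n)))
        \<longlonglongrightarrow> partial_deriv i f x"
      by (rule filterlim_compose)
    from tendsto_minus[OF this] show ?thesis
      by (simp add: g_def neg_difference_apply algebra_simps)
  qed
  have "(\<lambda>n. foldr neg_difference ihs (g n) x) \<longlonglongrightarrow>
      foldr neg_difference ihs (\<lambda>x. - partial_deriv i f x) x"
    by (rule foldr_neg_difference_tendsto[OF ihs _ x]) (rule lim)
  then
  show "0 \<le> foldr neg_difference ihs (\<lambda>x. - partial_deriv i f x) x"
  proof (rule LIMSEQ_le_const, intro exI allI impI)
    fix n
    \<comment> \<open>Appending at the end of the list applies the new difference first, directly to
      \<open>f\<close>.\<close>
    have "0 \<le> foldr neg_difference (ihs @ [(i, 1 / real (Suc n))]) f x"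
      using f ihs i x by (auto simp: alternating_differences_def simp del: foldr_append)
    then show "0 \<le> foldr neg_difference ihs (g n) x"
      unfolding g_def foldr_neg_difference_scale by simp
  qed
qed

text \<open>
  Alternating differences pass to derivatives as limits of difference quotients, so that
  no integral has to be differentiated.
\<close>

lemma completely_monotone_alternating_differences:
  assumes "finite I" and smooth: "smooth_on_orthant I f" and alt: "alternating_differences I f"
  shows "completely_monotone I f"
proof -
  have "alternating_differences I (\<lambda>x. (-1) ^ length es * iterated_partial_deriv es f x)"
    if "es \<in> lists I" for es
    using that
  proof (induction es)
    case Nil
    with alt show ?case
      by (simp add: iterated_partial_deriv_def)
  next
    case (Cons i es)
    let ?c = "(-1) ^ length es :: real"
    have diff: "(\<lambda>t. iterated_partial_deriv es f (x(i := t))) differentiable at (x i)"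
      if "x \<in> open_orthant I" for x
      using smooth Cons.hyps that by (auto simp: smooth_on_orthant_def)
    \<comment> \<open>The sign is moved out of the derivative. The identity is available on the
      orthant, which is where iterated differences evaluate the function.\<close>
    have *: "- partial_deriv i (\<lambda>x. ?c * iterated_partial_deriv es f x) x =
        (-1) ^ length (i # es) * iterated_partial_deriv (i # es) f x" if "x \<in> open_orthant I" for x
    proof -
      have "((\<lambda>t. iterated_partial_deriv es f (x(i := t))) has_real_derivative
          iterated_partial_deriv (i # es) f x) (at (x i))"
        using diff[OF that] unfolding DERIV_deriv_iff_real_differentiable[symmetric]
        by (simp add: iterated_partial_deriv_def partial_deriv_def)
      from DERIV_imp_deriv[OF DERIV_cmult[OF this, of ?c]] show ?thesis
        by (simp add: partial_deriv_def)
    qed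
    have "alternating_differences I (\<lambda>x. - partial_deriv i (\<lambda>x. ?c * iterated_partial_deriv es f x) x)"
      using Cons diff by (intro alternating_differences_partial_deriv) (auto intro: differentiable_mult)
    then show ?case
      unfolding alternating_differences_def
      by (auto simp: foldr_neg_difference_cong[OF _ *])
  qed
  \<comment> \<open>The empty list of differences yields the sign of the derivative itself.\<close>
  then have "0 \<le> (-1) ^ length es * iterated_partial_deriv es f x"
    if "es \<in> lists I" "x \<in> open_orthant I" for es x
    using that by (force simp: alternating_differences_def dest: bspec[of _ _ "[]"])
  moreover have "(\<Sum>i\<in>I. \<alpha> i) = length es" if "es \<in> lists I" "\<forall>i\<in>I. count_list es i = \<alpha> i" for es \<alpha>
    using sum_count_set[of es I] \<open>finite I\<close> that by auto
  ultimately show ?thesis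
    using smooth by (auto simp: completely_monotone_def)
qed

text \<open>Under the integral, each difference in direction \<open>i\<close> with step
  \<open>h\<close> becomes a factor \<open>1 - exp (- (h * t i))\<close>, which is nonnegative for
  \<open>t i \<ge> 0\<close>. Bochner integrals are used because differences are subtracted;
  integrability comes from the finite values \<open>f x\<close>.\<close>

lemma alternating_differences_laplace:
  assumes "finite I"
    and meas [measurable]: "\<And>i. i \<in> I \<Longrightarrow> (\<lambda>t. t i) \<in> borel_measurable M"
    and nonneg: "\<And>i. i \<in> I \<Longrightarrow> AE t in M. 0 \<le> t i"
    and f: "\<And>x. x \<in> open_orthant I \<Longrightarrow> 0 \<le> f x"
      "\<And>x. x \<in> open_orthant I \<Longrightarrow>
        ennreal (f x) = (\<integral>\<^sup>+t. ennreal (exp (- (\<Sum>i\<in>I. x i * t i))) \<partial>M)"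
  shows "alternating_differences I f"
  unfolding alternating_differences_def
proof (intro ballI)
  fix ihs x assume ihs: "ihs \<in> lists (I \<times> {0::real<..})" and x: "x \<in> open_orthant I"
  have int: "has_bochner_integral M
      (\<lambda>t. (\<Prod>(i, h)\<leftarrow>ihs. 1 - exp (- (h * t i))) * exp (- (\<Sum>i\<in>I. x i * t i)))
      (foldr neg_difference ihs f x)"
    using ihs x
  proof (induction ihs arbitrary: x)
    case Nil
    then show ?case
      using f by (auto intro!: has_bochner_integral_nn_integral)
  next
    case (Cons ih ihs)
    obtain i h where ih: "ih = (i, h)" by (cases ih)
    with Cons.hyps Cons.prems have i: "i \<in> I" "0 < h" by auto
    let ?x = "x(i := x i + h)"
    let ?W = "\<lambda>t. \<Prod>(i, h)\<leftarrow>ihs. 1 - exp (- (h * t i))"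
    have "?x \<in> open_orthant I"
      using Cons.prems i by (intro open_orthant_add)
    then have "has_bochner_integral M
        (\<lambda>t. ?W t * exp (- (\<Sum>i\<in>I. x i * t i)) - ?W t * exp (- (\<Sum>i\<in>I. ?x i * t i)))
        (foldr neg_difference ihs f x - foldr neg_difference ihs f ?x)"
      using Cons.prems by (intro has_bochner_integral_diff Cons.IH) (auto simp del: fun_upd_apply)
    moreover have "exp (- (\<Sum>j\<in>I. ?x j * t j)) = exp (- (h * t i)) * exp (- (\<Sum>j\<in>I. x j * t j))" for t
    proof -
      have "(\<Sum>j\<in>I. ?x j * t j) = (\<Sum>j\<in>I. x j * t j + (if j = i then h * t i else 0))"
        by (intro sum.cong) (auto simp: algebra_simps)
      also have "\<dots> = h * t i + (\<Sum>j\<in>I. x j * t j)"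
        using \<open>finite I\<close> i by (simp add: sum.distrib)
      finally show ?thesis
        by (simp add: exp_add[symmetric])
    qed
    ultimately show ?case
      by (simp add: ih neg_difference_apply algebra_simps)
  qed
  have "AE t in M. 0 \<le> (\<Prod>(i, h)\<leftarrow>ihs. 1 - exp (- (h * t i))) * exp (- (\<Sum>i\<in>I. x i * t i))"
  proof -
    have "AE t in M. \<forall>i\<in>I. 0 \<le> t i"
      using \<open>finite I\<close> nonneg by (intro AE_finite_allI) auto
    then show ?thesis
    proof eventually_elim
      case (elim t)
      have "0 \<le> 1 - exp (- (h * t i))" if "(i, h) \<in> set ihs" for i h
      proof -
        have "i \<in> I" "0 < h"
          using ihs that by auto
        with elim show ?thesis by simp
      qed
      then have "0 \<le> (\<Prod>(i, h)\<leftarrow>ihs. 1 - exp (- (h * t i)))"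
        by (intro prod_list_nonneg) force
      then show ?case by simp
    qed
  qed
  from integral_nonneg_AE[OF this] show "0 \<le> foldr neg_difference ihs f x"
    by (simp only: has_bochner_integral_integral_eq[OF int])
qed

section \<open>Laplace representations\<close>

lemma finite_spanning_trees: "finite (edges G) \<Longrightarrow> finite (spanning_trees G)"
  by (rule finite_subset[of _ "Pow (edges G)"]) (auto simp: spanning_trees_def)

lemma spanning_tree_poly_cong:
  "(\<And>e. e \<in> edges G \<Longrightarrow> x e = y e) \<Longrightarrow> spanning_tree_poly G x = spanning_tree_poly G y"
  unfolding spanning_tree_poly_def
  by (intro sum.cong prod.cong) (auto simp: spanning_trees_def)

lemma finite_connected_graph_edges: "finite_connected_graph G \<Longrightarrow> finite (edges G)"
  using simple_graph_finite_edges[of "verts G" "edges G"] by (simp add: finite_connected_graph_def simple_graph_def)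

lemma spanning_tree_poly_pos:
  assumes G: "finite_connected_graph G" and x: "x \<in> open_orthant (edges G)"
  shows "0 < spanning_tree_poly G x"
proof -
  have G': "finite (verts G)" "simple_graph \<lparr>verts = verts G, edges = edges G\<rparr>"
    "connected_graph \<lparr>verts = verts G, edges = edges G\<rparr>"
    using G by (simp_all add: finite_connected_graph_def simple_graph_def connected_graph_def)
  obtain T where T: "T \<subseteq> edges G" "connected_graph \<lparr>verts = verts G, edges = T\<rparr>"
      "card T + 1 = card (verts G)"
    using connected_graph_subtree[OF G'(1,3,2)] .
  then have "tree \<lparr>verts = verts G, edges = T\<rparr>"
    using G' by (subst tree_iff_card) (auto simp: simple_graph_def)
  with T have "T \<in> spanning_trees G"
    by (simp add: spanning_trees_def)
  moreover have "0 < (\<Prod>e\<in>T. x e)" if "T \<in> spanning_trees G" for T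
    using that open_orthant_pos[OF x] by (intro prod_pos) (auto simp: spanning_trees_def)
  ultimately show ?thesis
    unfolding spanning_tree_poly_def
    using finite_spanning_trees[OF finite_connected_graph_edges[OF G]] by (intro sum_pos) auto
qed

lemma two_subset_cases:
  assumes "T \<subseteq> {p, q, r}" "card T = 2"
  shows "T \<in> {{p, q}, {q, r}, {p, r}}"
proof -
  obtain u w where "T = {u, w}" "u \<noteq> w"
    using assms(2) by (auto simp: card_2_iff)
  with assms(1) show ?thesis by auto
qed

lemma spanning_tree_poly_triangle:
  assumes abc: "distinct [a, b, c]"
  shows "spanning_tree_poly \<lparr>verts = {a, b, c}, edges = {{a, b}, {b, c}, {a, c}}\<rparr> x =
    x {a, b} * x {b, c} + x {b, c} * x {a, c} + x {a, b} * x {a, c}"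
proof -
  let ?G = "\<lparr>verts = {a, b, c}, edges = {{a, b}, {b, c}, {a, c}}\<rparr>"
  have neq: "{a, b} \<noteq> {b, c}" "{a, b} \<noteq> {a, c}" "{b, c} \<noteq> {a, c}"
    using abc by (auto simp: doubleton_eq_iff)
  have "spanning_trees ?G = {{{a, b}, {b, c}}, {{b, c}, {a, c}}, {{a, b}, {a, c}}}"
  proof (rule set_eqI)
    fix T
    show "T \<in> spanning_trees ?G \<longleftrightarrow> T \<in> {{{a, b}, {b, c}}, {{b, c}, {a, c}}, {{a, b}, {a, c}}}"
    proof
      assume T: "T \<in> spanning_trees ?G"
      then have sub: "T \<in> Pow {{a, b}, {b, c}, {a, c}}"
        by (simp add: spanning_trees_def)
      with abc have "simple_graph \<lparr>verts = {a, b, c}, edges = T\<rparr>"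
        by (auto simp: simple_graph_def)
      with T have "card T + 1 = card {a, b, c}"
        using tree_iff_card[of "{a, b, c}" T] by (auto simp: spanning_trees_def)
      with abc have "card T = 2" by simp
      with sub show "T \<in> {{{a, b}, {b, c}}, {{b, c}, {a, c}}, {{a, b}, {a, c}}}"
        by (intro two_subset_cases) auto
    next
      assume "T \<in> {{{a, b}, {b, c}}, {{b, c}, {a, c}}, {{a, b}, {a, c}}}"
      then show "T \<in> spanning_trees ?G"
        using tree_two_edges[of a b c] tree_two_edges[of b c a] tree_two_edges[of b a c] abc
        by (auto simp: spanning_trees_def insert_commute)
    qed
  qed
  then have "spanning_tree_poly ?G x =
      (\<Sum>T\<in>{{{a, b}, {b, c}}, {{b, c}, {a, c}}, {{a, b}, {a, c}}}. \<Prod>e\<in>T. x e)"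
    by (simp add: spanning_tree_poly_def)
  also have "\<dots> = (\<Prod>e\<in>{{a, b}, {b, c}}. x e) + (\<Prod>e\<in>{{b, c}, {a, c}}. x e) + (\<Prod>e\<in>{{a, b}, {a, c}}. x e)"
    using neq by (simp add: doubleton_eq_iff[of "{a, b}"] doubleton_eq_iff[of "{b, c}"])
  also have "\<dots> = x {a, b} * x {b, c} + x {b, c} * x {a, c} + x {a, b} * x {a, c}"
    using neq by simp
  finally show ?thesis .
qed

section \<open>The triangle condition on unordered faces\<close>

definition heron_set :: "('v set \<Rightarrow> real) \<Rightarrow> 'v set \<Rightarrow> bool" where
  "heron_set t f \<longleftrightarrow> (\<forall>a b c. distinct [a, b, c] \<longrightarrow> f = {a, b, c} \<longrightarrow>
    heron (t {a, b}) (t {a, c}) (t {b, c}))"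

text \<open>A face carries no order of its vertices. The two transpositions in
  \<open>heron_commute\<close> generate all six relabellings, so one of them decides.\<close>

lemma heron_setI:
  assumes "distinct [a, b, c]" "heron (t {a, b}) (t {a, c}) (t {b, c})"
  shows "heron_set t {a, b, c}"
  unfolding heron_set_def
proof (intro allI impI)
  fix a' b' c' assume *: "distinct [a', b', c']" "{a, b, c} = {a', b', c'}"
  then have "a' \<in> {a, b, c}" "b' \<in> {a, b, c}" "c' \<in> {a, b, c}" by simp_all
  with *(1) have "a' = a \<and> b' = b \<and> c' = c \<or> a' = a \<and> b' = c \<and> c' = b \<or> a' = b \<and> b' = a \<and> c' = c
      \<or> a' = b \<and> b' = c \<and> c' = a \<or> a' = c \<and> b' = a \<and> c' = b \<or> a' = c \<and> b' = b \<and> c' = a"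
    by (elim insertE emptyE) simp_all
  moreover have "{b, a} = {a, b}" "{c, a} = {a, c}" "{c, b} = {b, c}" by auto
  moreover note assms(2)
  moreover from heron_commute[OF this] have
    "heron (t {a, c}) (t {a, b}) (t {b, c})" "heron (t {a, b}) (t {b, c}) (t {a, c})" .
  moreover from heron_commute(2)[OF this(1)] heron_commute(1)[OF this(2)] have
    "heron (t {a, c}) (t {b, c}) (t {a, b})" "heron (t {b, c}) (t {a, b}) (t {a, c})" .
  moreover from heron_commute(1)[OF this(1)] have
    "heron (t {b, c}) (t {a, c}) (t {a, b})" .
  ultimately show "heron (t {a', b'}) (t {a', c'}) (t {b', c'})"
    by (elim disjE conjE) (simp_all only:)
qed

lemma heron_setD: "heron_set t {a, b, c} \<Longrightarrow> distinct [a, b, c] \<Longrightarrow> heron (t {a, b}) (t {a, c}) (t {b, c})"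
  unfolding heron_set_def by blast

lemma measurable_heron:
  assumes [measurable]: "f \<in> borel_measurable M" "g \<in> borel_measurable M" "h \<in> borel_measurable M"
  shows "{x \<in> space M. heron (f x) (g x) (h x)} \<in> sets M"
  unfolding heron_def by measurable

lemma measurable_heron_set:
  assumes "distinct [a, b, c]" "{{a, b}, {b, c}, {a, c}} \<subseteq> E"
  shows "{t \<in> space (PiM E (\<lambda>_. borel)). heron_set t {a, b, c}} \<in> sets (PiM E (\<lambda>_. borel))"
proof -
  have "heron_set t {a, b, c} \<longleftrightarrow> heron (t {a, b}) (t {a, c}) (t {b, c})" for t
    using heron_setI[OF assms(1)] heron_setD[OF _ assms(1)] by blast
  then have "{t \<in> space (PiM E (\<lambda>_. borel)). heron_set t {a, b, c}} =
      {t \<in> space (PiM E (\<lambda>_. borel)). heron (t {a, b}) (t {a, c}) (t {b, c})}" by simp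
  also have "\<dots> \<in> sets (PiM E (\<lambda>_. borel))"
    using assms(2) by (intro measurable_heron measurable_component_singleton) auto
  finally show ?thesis .
qed

text \<open>The induction invariant. Besides the Laplace transform it records nonnegative weights,
  needed for the alternating differences, and the triangle condition on all current faces, needed
  for the next insertion.\<close>

definition laplace_representation :: "real \<Rightarrow> 'v ugraph \<Rightarrow> 'v set multiset \<Rightarrow> ('v set \<Rightarrow> real) measure \<Rightarrow> bool" where
  "laplace_representation \<beta> G F M \<longleftrightarrow>
    sets M = sets (PiM (edges G) (\<lambda>_. borel)) \<and>
    (\<forall>e\<in>edges G. AE t in M. 0 \<le> t e) \<and>
    (\<forall>f\<in>#F. AE t in M. heron_set t f) \<and>
    (\<forall>x\<in>open_orthant (edges G). (\<integral>\<^sup>+t. ennreal (exp (- (\<Sum>e\<in>edges G. x e * t e))) \<partial>M) =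
      ennreal (spanning_tree_poly G x powr - \<beta>))"

lemma measurable_elevated_dist [measurable (raw)]:
  assumes [measurable]: "f \<in> borel_measurable M" "g \<in> borel_measurable M"
    "w \<in> M \<rightarrow>\<^sub>M (borel \<Otimes>\<^sub>M borel) \<Otimes>\<^sub>M borel"
  shows "(\<lambda>u. elevated_dist (f u) (g u) (w u)) \<in> borel_measurable M"
  unfolding elevated_dist_def by measurable

lemma measurable_apex [measurable (raw)]:
  assumes [measurable]: "f \<in> borel_measurable M" "g \<in> borel_measurable M" "h \<in> borel_measurable M"
  shows "(\<lambda>u. apex_x (f u) (g u) (h u)) \<in> borel_measurable M"
    "(\<lambda>u. apex_y (f u) (g u) (h u)) \<in> borel_measurable M"
  unfolding apex_x_def apex_y_def by measurable

text \<open>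
  The third vertex of the triangle is placed above the plane by the same kernel, with weight 0 for
  one of the three foot points.
\<close>

lemma laplace_representation_triangle:
  assumes abc: "distinct [a, b, c]" and \<beta>: "1 < \<beta>"
  shows "\<exists>M. laplace_representation \<beta> \<lparr>verts = {a, b, c}, edges = {{a, b}, {b, c}, {a, c}}\<rparr>
    {#{a, b, c}, {a, b, c}#} M"
proof -
  let ?E = "{{a, b}, {b, c}, {a, c}}"
  let ?G = "\<lparr>verts = {a, b, c}, edges = ?E\<rparr>"
  let ?K = "kernel_measure (\<beta> - 1)"
  interpret K: sigma_finite_measure ?K by (rule sigma_finite_kernel_measure)
  define N where "N = gamma_measure \<beta> \<Otimes>\<^sub>M ?K"
  \<comment> \<open>The base \<open>{a, b}\<close> has squared length \<open>fst u\<close>, and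
    \<open>c\<close> is the elevated point over the line through \<open>a\<close> and
    \<open>b\<close>.\<close>
  define \<tau> where "\<tau> = (\<lambda>u. \<lambda>e\<in>?E. if e = {a, b} then fst u
    else if e = {a, c} then elevated_dist 0 0 (snd u) else elevated_dist (sqrt (fst u)) 0 (snd u))"
  define M where "M = distr N (PiM ?E (\<lambda>_. borel)) \<tau>"
  have [measurable_cong]: "sets N = sets (borel \<Otimes>\<^sub>M ((borel \<Otimes>\<^sub>M borel) \<Otimes>\<^sub>M borel))"
    unfolding N_def by (intro sets_pair_measure_cong) simp_all
  have neq: "{a, b} \<noteq> {b, c}" "{a, b} \<noteq> {a, c}" "{b, c} \<noteq> {a, c}"
    using abc by (auto simp: doubleton_eq_iff)
  have \<tau>: "\<tau> u {a, b} = fst u" "\<tau> u {a, c} = elevated_dist 0 0 (snd u)"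
    "\<tau> u {b, c} = elevated_dist (sqrt (fst u)) 0 (snd u)" for u
    using neq by (auto simp: \<tau>_def)
  have [measurable]: "\<tau> \<in> N \<rightarrow>\<^sub>M PiM ?E (\<lambda>_. borel)"
    unfolding \<tau>_def by measurable
  have AE_N: "AE u in N. 0 \<le> fst u \<and> 0 \<le> snd (snd u)"
    unfolding N_def
    using AE_pair_measure_fst[OF K.sigma_finite_measure_axioms AE_gamma_measure[of \<beta>]]
      AE_pair_measure_snd[OF K.sigma_finite_measure_axioms AE_kernel_measure[of "\<beta> - 1"]]
    by eventually_elim simp
  have AE_M: "AE t in M. P t" if "\<And>u. 0 \<le> fst u \<Longrightarrow> 0 \<le> snd (snd u) \<Longrightarrow> P (\<tau> u)"
      "{t \<in> space (PiM ?E (\<lambda>_. borel)). P t} \<in> sets (PiM ?E (\<lambda>_. borel))" for P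
    unfolding M_def using AE_N that by (subst AE_distr_iff) auto
  have M_nonneg: "AE t in M. 0 \<le> t e" if "e \<in> ?E" for e
  proof (rule AE_M)
    have [measurable]: "(\<lambda>t. t e) \<in> borel_measurable (PiM ?E (\<lambda>_. borel :: real measure))"
      using that by (rule measurable_component_singleton)
    show "{t \<in> space (PiM ?E (\<lambda>_. borel)). 0 \<le> t e} \<in> sets (PiM ?E (\<lambda>_. borel :: real measure))"
      by measurable
  qed (use that in \<open>auto simp: \<tau> elevated_dist_nonneg\<close>)
  have M_heron: "AE t in M. heron_set t {a, b, c}"
  proof (rule AE_M[OF heron_setI[OF abc] measurable_heron_set[OF abc subset_refl]])
    show "heron (\<tau> u {a, b}) (\<tau> u {a, c}) (\<tau> u {b, c})" if "0 \<le> fst u" "0 \<le> snd (snd u)" for u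
      unfolding \<tau> using heron_elevated[OF that(2), of 0 "sqrt (fst u)" 0 0] that by simp
  qed
  have M_int: "(\<integral>\<^sup>+t. ennreal (exp (- (\<Sum>e\<in>?E. x e * t e))) \<partial>M) =
      ennreal (spanning_tree_poly ?G x powr - \<beta>)" if x: "x \<in> open_orthant ?E" for x
  proof -
    define p q r S where "p = x {a, b}" "q = x {a, c}" "r = x {b, c}" "S = q + r"
    have pos: "0 < p" "0 < q" "0 < r" "0 < S"
      using open_orthant_pos[OF x] by (auto simp: p_q_r_S_def add_pos_pos)
    have "(\<integral>\<^sup>+t. ennreal (exp (- (\<Sum>e\<in>?E. x e * t e))) \<partial>M) =
        (\<integral>\<^sup>+u. ennreal (exp (- (p * fst u))) * ennreal (exp (- (q * elevated_dist 0 0 (snd u)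
          + r * elevated_dist (sqrt (fst u)) 0 (snd u) + 0 * elevated_dist 0 0 (snd u)))) \<partial>N)"
      unfolding M_def using neq
      by (subst nn_integral_distr)
        (auto simp: \<tau> p_q_r_S_def ennreal_mult'[symmetric] exp_add[symmetric] algebra_simps
          intro!: nn_integral_cong)
    also have "\<dots> = (\<integral>\<^sup>+s. ennreal (exp (- (p * s))) * (\<integral>\<^sup>+w. ennreal (exp (- (q * elevated_dist 0 0 w
          + r * elevated_dist (sqrt s) 0 w + 0 * elevated_dist 0 0 w))) \<partial>?K) \<partial>gamma_measure \<beta>)"
      unfolding N_def by (subst K.nn_integral_fst[symmetric]) (auto simp: nn_integral_cmult)
    \<comment> \<open>The kernel adds \<open>q * r / S\<close> to the coefficient of the base length
      \<open>s\<close>. The remaining Gamma integral gives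
      \<open>(p + q * r / S) powr - \<beta>\<close>, and the product of \<open>S\<close> with
      \<open>p + q * r / S\<close> is the triangle polynomial.\<close>
    also have "\<dots> = (\<integral>\<^sup>+s. ennreal (S powr - \<beta>) * ennreal (exp (- ((p + q * r / S) * s))) \<partial>gamma_measure \<beta>)"
    proof (rule nn_integral_cong_AE)
      show "AE s in gamma_measure \<beta>.
        ennreal (exp (- (p * s))) * (\<integral>\<^sup>+w. ennreal (exp (- (q * elevated_dist 0 0 w
          + r * elevated_dist (sqrt s) 0 w + 0 * elevated_dist 0 0 w))) \<partial>?K) =
        ennreal (S powr - \<beta>) * ennreal (exp (- ((p + q * r / S) * s)))"
        using AE_gamma_measure
      proof eventually_elim
        case (elim s)
        then show ?case
          using \<beta> pos by (subst nn_integral_kernel_measure[where S = S])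
            (auto simp: p_q_r_S_def ennreal_mult'[symmetric] exp_add[symmetric] algebra_simps)
      qed
    qed
    also have "\<dots> = ennreal (S powr - \<beta> * (p + q * r / S) powr - \<beta>)"
      using \<beta> pos by (subst nn_integral_cmult)
        (auto simp: nn_integral_gamma_measure add_pos_pos ennreal_mult'[symmetric])
    also have "S powr - \<beta> * (p + q * r / S) powr - \<beta> = (S * (p + q * r / S)) powr - \<beta>"
      using pos by (simp add: powr_mult)
    also have "S * (p + q * r / S) = spanning_tree_poly ?G x"
      unfolding spanning_tree_poly_triangle[OF abc] using pos
      by (simp add: p_q_r_S_def[symmetric] field_simps) (simp add: p_q_r_S_def algebra_simps)
    finally show ?thesis .
  qed
  have "sets M = sets (PiM ?E (\<lambda>_. borel))"
    by (simp only: M_def sets_distr)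
  moreover have "\<forall>f\<in>#{#{a, b, c}, {a, b, c}#}. AE t in M. heron_set t f"
    using M_heron by simp
  ultimately show ?thesis
    unfolding laplace_representation_def ugraph.simps using M_nonneg M_int by blast
qed

section \<open>Insertion of a vertex\<close>

lemma heron_set_cong:
  assumes "\<And>u w. u \<in> f \<Longrightarrow> w \<in> f \<Longrightarrow> u \<noteq> w \<Longrightarrow> t {u, w} = t' {u, w}"
  shows "heron_set t f \<longleftrightarrow> heron_set t' f"
proof -
  have "heron (t {a, b}) (t {a, c}) (t {b, c}) \<longleftrightarrow> heron (t' {a, b}) (t' {a, c}) (t' {b, c})"
    if "distinct [a, b, c]" "f = {a, b, c}" for a b c
    using assms[of a b] assms[of a c] assms[of b c] that by simp
  then show ?thesis
    unfolding heron_set_def by blast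
qed

text \<open>Ensures that the weights tested by \<open>heron_set\<close> on a face are coordinates of
  the representing measure, and that later insertions leave them unchanged.\<close>

lemma plane_apollonian_face_edges:
  assumes "plane_apollonian G F" "f \<in># F" "u \<in> f" "w \<in> f" "u \<noteq> w"
  shows "{u, w} \<in> edges G"
  using assms
proof (induction arbitrary: f u w)
  case (triangle a b c)
  then show ?case by (auto simp: insert_commute)
next
  case (insert_vertex G F a b c v)
  have abc: "{a, b} \<in> edges G" "{b, c} \<in> edges G" "{a, c} \<in> edges G"
    using insert_vertex.IH[OF insert_vertex.hyps(2)] insert_vertex.hyps(3) by auto
  from insert_vertex.prems(1) consider "f \<in># F" | "f \<in> {{v, a, b}, {v, b, c}, {v, a, c}}"
    by (auto dest: in_diffD)
  then show ?case
  proof cases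
    case 1
    with insert_vertex show ?thesis by simp
  next
    case 2
    with abc insert_vertex.prems(2-4) show ?thesis by (auto simp: insert_commute)
  qed
qed

lemma measurable_exp_sum:
  "(\<lambda>t. ennreal (exp (- (\<Sum>e\<in>E. x e * t e)))) \<in> borel_measurable (PiM E (\<lambda>_. borel :: real measure))"
proof -
  have [measurable]: "(\<lambda>t. \<Sum>e\<in>E. x e * t e) \<in> borel_measurable (PiM E (\<lambda>_. borel :: real measure))"
    by (intro borel_measurable_sum borel_measurable_times borel_measurable_const
        measurable_component_singleton)
  show ?thesis by measurable
qed

text \<open>For given old weights \<open>t\<close>, the face is placed in the plane with
  \<open>a\<close> at the origin, \<open>b\<close> on the first axis and \<open>c\<close> at the
  apex, and the kernel distributes the point \<open>v\<close> above it. The new measure is the image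
  of the product of \<open>L\<close> with the kernel under the map \<open>\<tau>\<close> to old and
  new weights.\<close>

lemma laplace_representation_insert_vertex:
  assumes "plane_apollonian G F" and f: "{a, b, c} \<in># F" and abc: "distinct [a, b, c]"
    and v: "v \<notin> verts G" and \<beta>: "1 < \<beta>" and L: "laplace_representation \<beta> G F L"
  shows "\<exists>M. laplace_representation \<beta>
    \<lparr>verts = insert v (verts G), edges = edges G \<union> {{v, a}, {v, b}, {v, c}}\<rparr>
    (F - {#{a, b, c}#} + {#{v, a, b}, {v, b, c}, {v, a, c}#}) M"
proof -
  define V E where "V = verts G" "E = edges G"
  let ?E = "E \<union> {{v, a}, {v, b}, {v, c}}"
  let ?H = "\<lparr>verts = insert v V, edges = ?E\<rparr>"
  let ?K = "kernel_measure (\<beta> - 1)"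
  have G: "G = \<lparr>verts = V, edges = E\<rparr>"
    by (simp add: V_E_def)
  have fcg: "finite_connected_graph G" and faces: "\<And>f. f \<in># F \<Longrightarrow> f \<subseteq> V"
    using plane_apollonian_finite_connected[OF assms(1)] by (auto simp: V_E_def)
  then have V: "finite V" and E: "simple_graph \<lparr>verts = V, edges = E\<rparr>" and finE: "finite E"
    using finite_connected_graph_edges[OF fcg] by (auto simp: finite_connected_graph_def V_E_def simple_graph_def)
  have face_edges: "{u, w} \<in> E" if "f \<in># F" "u \<in> f" "w \<in> f" "u \<noteq> w" for f u w
    using plane_apollonian_face_edges[OF assms(1) that] by (simp add: V_E_def)
  have abcE: "{a, b} \<in> E" "{b, c} \<in> E" "{a, c} \<in> E"
    using face_edges[OF f] abc by auto
  have vV: "v \<notin> V" and vabc: "v \<noteq> a" "v \<noteq> b" "v \<noteq> c" and abcV: "{a, b, c} \<subseteq> V"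
    using v faces[OF f] by (auto simp: V_E_def)
  have star_E: "{v, u} \<notin> E" for u
    using E vV by (auto simp: simple_graph_def)
  have star_neq: "{v, a} \<noteq> {v, b}" "{v, a} \<noteq> {v, c}" "{v, b} \<noteq> {v, c}"
    and tri_neq: "{a, b} \<noteq> {b, c}" "{a, b} \<noteq> {a, c}" "{b, c} \<noteq> {a, c}"
    using abc by (auto simp: doubleton_eq_iff)
  have setsL [measurable_cong]: "sets L = sets (PiM E (\<lambda>_. borel))"
    and L_nonneg: "\<And>e. e \<in> E \<Longrightarrow> AE t in L. 0 \<le> t e"
    and L_heron: "\<And>f. f \<in># F \<Longrightarrow> AE t in L. heron_set t f"
    and L_int: "\<And>x. x \<in> open_orthant E \<Longrightarrow>
      (\<integral>\<^sup>+t. ennreal (exp (- (\<Sum>e\<in>E. x e * t e))) \<partial>L) = ennreal (spanning_tree_poly G x powr - \<beta>)"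
    using L by (auto simp: laplace_representation_def V_E_def)
  \<comment> \<open>Tonelli's theorem and the transfer of null sets ask for a sigma-finite second
    factor. The kernel is therefore put second in \<open>N\<close>, since
    \<open>laplace_representation\<close> makes no such claim about \<open>L\<close>.\<close>
  interpret K: sigma_finite_measure ?K by (rule sigma_finite_kernel_measure)
  define da where "da t w = elevated_dist 0 0 w" for t :: "'a set \<Rightarrow> real" and w
  define db where "db t w = elevated_dist (sqrt (t {a, b})) 0 w" for t w
  define dc where "dc t w = elevated_dist (apex_x (t {a, b}) (t {a, c}) (t {b, c}))
    (apex_y (t {a, b}) (t {a, c}) (t {b, c})) w" for t w
  define N where "N = L \<Otimes>\<^sub>M ?K"
  define \<tau> where "\<tau> = (\<lambda>u. \<lambda>e\<in>?E. if e = {v, a} then da (fst u) (snd u)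
    else if e = {v, b} then db (fst u) (snd u) else if e = {v, c} then dc (fst u) (snd u) else fst u e)"
  define M where "M = distr N (PiM ?E (\<lambda>_. borel)) \<tau>"
  have setsN [measurable_cong]: "sets N = sets (PiM E (\<lambda>_. borel) \<Otimes>\<^sub>M ((borel \<Otimes>\<^sub>M borel) \<Otimes>\<^sub>M borel))"
    unfolding N_def by (intro sets_pair_measure_cong setsL) simp
  have coord [measurable]: "(\<lambda>t. t e) \<in> borel_measurable L" if "e \<in> E" for e
    using that measurable_component_singleton[of e E "\<lambda>_. borel"]
    by (simp cong: measurable_cong_sets add: measurable_cong_sets[OF setsL refl])
  have [measurable]: "(\<lambda>u. fst u e) \<in> borel_measurable N" if "e \<in> E" for e
    using measurable_compose[OF measurable_fst coord[OF that]] unfolding N_def .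
  have sndN [measurable]: "snd \<in> N \<rightarrow>\<^sub>M (borel \<Otimes>\<^sub>M borel) \<Otimes>\<^sub>M borel"
    by (simp add: measurable_cong_sets[OF setsN refl])
  have d_measurable [measurable]: "(\<lambda>u. da (fst u) (snd u)) \<in> borel_measurable N"
    "(\<lambda>u. db (fst u) (snd u)) \<in> borel_measurable N" "(\<lambda>u. dc (fst u) (snd u)) \<in> borel_measurable N"
    unfolding da_def db_def dc_def using abcE by measurable
  have \<tau>: "\<tau> u {v, a} = da (fst u) (snd u)" "\<tau> u {v, b} = db (fst u) (snd u)"
    "\<tau> u {v, c} = dc (fst u) (snd u)" for u
    using star_neq by (auto simp: \<tau>_def)
  have \<tau>E: "\<tau> u e = fst u e" if "e \<in> E" for u e
    using that star_E by (auto simp: \<tau>_def)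
  have \<tau>_measurable [measurable]: "\<tau> \<in> N \<rightarrow>\<^sub>M PiM ?E (\<lambda>_. borel)"
    unfolding \<tau>_def
  proof (rule measurable_restrict)
    fix e assume "e \<in> ?E"
    then consider "e \<in> E" "e \<noteq> {v, a}" "e \<noteq> {v, b}" "e \<noteq> {v, c}"
      | "e = {v, a}" | "e = {v, b}" | "e = {v, c}"
      using star_E by blast
    then show "(\<lambda>u. if e = {v, a} then da (fst u) (snd u) else if e = {v, b} then db (fst u) (snd u)
        else if e = {v, c} then dc (fst u) (snd u) else fst u e) \<in> borel_measurable N"
      by cases (simp_all add: star_neq star_neq[symmetric])
  qed
  have AE_fst: "AE u in N. P (fst u)" if "AE t in L. P t" for P
    unfolding N_def using AE_pair_measure_fst[OF K.sigma_finite_measure_axioms that] .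
  have AE_snd: "AE u in N. 0 \<le> snd (snd u)"
    unfolding N_def using AE_pair_measure_snd[OF K.sigma_finite_measure_axioms AE_kernel_measure] .
  have L_abc: "AE t in L. heron (t {a, b}) (t {a, c}) (t {b, c})"
    using L_heron[OF f] by (rule eventually_mono) (rule heron_setD[OF _ abc])
  have AE_M: "AE t in M. P t" if "AE u in N. P (\<tau> u)"
      "{t \<in> space (PiM ?E (\<lambda>_. borel)). P t} \<in> sets (PiM ?E (\<lambda>_. borel))" for P
    unfolding M_def using AE_distr_iff[OF \<tau>_measurable that(2)] that(1) by (rule iffD2)
  have M_nonneg: "AE t in M. 0 \<le> t e" if e: "e \<in> ?E" for e
  proof (rule AE_M)
    have [measurable]: "(\<lambda>t. t e) \<in> borel_measurable (PiM ?E (\<lambda>_. borel :: real measure))"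
      using that by (rule measurable_component_singleton)
    show "{t \<in> space (PiM ?E (\<lambda>_. borel)). 0 \<le> t e} \<in> sets (PiM ?E (\<lambda>_. borel :: real measure))"
      by measurable
    show "AE u in N. 0 \<le> \<tau> u e"
    proof (cases "e \<in> E")
      case True
      with AE_fst[OF L_nonneg[OF True]] show ?thesis by (simp add: \<tau>E)
    next
      case False
      show ?thesis
        using AE_snd
      proof eventually_elim
        case (elim u)
        with False e show ?case
          by (auto simp: \<tau> da_def db_def dc_def elevated_dist_nonneg)
      qed
    qed
  qed
  have M_heron: "AE t in M. heron_set t f'"
    if f': "f' \<in># F - {#{a, b, c}#} + {#{v, a, b}, {v, b, c}, {v, a, c}#}" for f'
  proof -
    have new: "AE u in N. heron_set (\<tau> u) {v, a, b} \<and> heron_set (\<tau> u) {v, b, c} \<and> heron_set (\<tau> u) {v, a, c}"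
      using AE_snd AE_fst[OF L_abc]
    proof eventually_elim
      case (elim u)
      note h = heron_face[OF elim, folded da_def[of "fst u"] db_def dc_def]
      from h show ?case
        using abc vabc abcE by (intro conjI heron_setI) (auto simp: \<tau> \<tau>E)
    qed
    from f' consider "f' \<in># F" | "f' = {v, a, b}" | "f' = {v, b, c}" | "f' = {v, a, c}"
      by (auto dest: in_diffD)
    then show ?thesis
    proof cases
      case 1
      show ?thesis
      \<comment> \<open>A set that is not of this form satisfies \<open>heron_set\<close> vacuously,
        which saves a proof that faces have three elements.\<close>
      proof (cases "\<exists>x y z. distinct [x, y, z] \<and> f' = {x, y, z}")
        case True
        then obtain x y z where xyz: "distinct [x, y, z]" "f' = {x, y, z}" by blast
        show ?thesis
          unfolding xyz(2)
        proof (rule AE_M)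
          show "{t \<in> space (PiM ?E (\<lambda>_. borel)). heron_set t {x, y, z}} \<in> sets (PiM ?E (\<lambda>_. borel))"
            using face_edges[OF 1] xyz by (intro measurable_heron_set) auto
          have "heron_set (\<tau> u) {x, y, z} \<longleftrightarrow> heron_set (fst u) {x, y, z}" for u
            using face_edges[OF 1] xyz(2) by (intro heron_set_cong \<tau>E) auto
          then show "AE u in N. heron_set (\<tau> u) {x, y, z}"
            using AE_fst[OF L_heron[OF 1]] xyz(2) by simp
        qed
      next
        case False
        then have "heron_set t f'" for t :: "'a set \<Rightarrow> real"
          unfolding heron_set_def by blast
        then show ?thesis by simp
      qed
    next
      case 2
      show ?thesis
        unfolding 2 using abc vabc abcE new by (intro AE_M measurable_heron_set) auto
    next
      case 3
      show ?thesis
        unfolding 3 using abc vabc abcE new by (intro AE_M measurable_heron_set) auto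
    next
      case 4
      show ?thesis
        unfolding 4 using abc vabc abcE new by (intro AE_M measurable_heron_set) auto
    qed
  qed
  have M_int: "(\<integral>\<^sup>+t. ennreal (exp (- (\<Sum>e\<in>?E. x e * t e))) \<partial>M) =
      ennreal (spanning_tree_poly ?H x powr - \<beta>)" if x: "x \<in> open_orthant ?E" for x
  proof -
    define p q r S where "p = x {v, a}" "q = x {v, b}" "r = x {v, c}" "S = p + q + r"
    define z where "z = (\<lambda>e. if e = {a, b} then p * q / S else if e = {b, c} then q * r / S
      else if e = {a, c} then p * r / S else 0)"
    \<comment> \<open>The weights after the star-triangle transformation, restricted to
      \<open>E\<close> because elements of \<open>open_orthant E\<close> are extensional.\<close>
    define y where "y = (\<lambda>e\<in>E. x e + z e)"
    have pos: "0 < p" "0 < q" "0 < r" "0 < S"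
      using open_orthant_pos[OF x] by (auto simp: p_q_r_S_def add_pos_pos)
    have y: "y \<in> open_orthant E"
      using open_orthant_pos[OF x] pos by (auto simp: y_def open_orthant_def z_def add_pos_pos)
    \<comment> \<open>The exponent produced by the kernel is linear in \<open>t\<close>, so it
      amounts to a shift of the Laplace variable from \<open>x\<close> to \<open>y\<close>.\<close>
    have yt: "(\<Sum>e\<in>E. y e * t e) = (\<Sum>e\<in>E. x e * t e) +
        (p * q * t {a, b} + q * r * t {b, c} + p * r * t {a, c}) / S" for t
    proof -
      have "(\<Sum>e\<in>E. z e * t e) = (\<Sum>e\<in>{{a, b}, {b, c}, {a, c}}. z e * t e)"
        using finE abcE by (intro sum.mono_neutral_right) (auto simp: z_def)
      also have "\<dots> = (p * q * t {a, b} + q * r * t {b, c} + p * r * t {a, c}) / S"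
        using tri_neq by (simp add: z_def add_divide_distrib)
      finally show ?thesis
        by (simp add: y_def distrib_right sum.distrib)
    qed
    have split: "(\<Sum>e\<in>?E. x e * \<tau> u e) = (\<Sum>e\<in>E. x e * fst u e) +
        (p * da (fst u) (snd u) + q * db (fst u) (snd u) + r * dc (fst u) (snd u))" for u
    proof -
      have "(\<Sum>e\<in>?E. x e * \<tau> u e) = (\<Sum>e\<in>E. x e * \<tau> u e) + (\<Sum>e\<in>{{v, a}, {v, b}, {v, c}}. x e * \<tau> u e)"
        using finE star_E by (intro sum.union_disjoint) auto
      then show ?thesis
        using star_neq by (simp add: \<tau> \<tau>E p_q_r_S_def)
    qed
    define X where "X t = ennreal (exp (- (\<Sum>e\<in>E. x e * t e)))" for t :: "'a set \<Rightarrow> real"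
    define Y where "Y t w = ennreal (exp (- (p * da t w + q * db t w + r * dc t w)))" for t w
    have [measurable]: "X \<in> borel_measurable L"
      unfolding X_def by measurable
    have [measurable]: "(\<lambda>u. Y (fst u) (snd u)) \<in> borel_measurable N"
      unfolding Y_def by measurable
    have [measurable]: "Y t \<in> borel_measurable ?K" for t
      unfolding Y_def da_def db_def dc_def by measurable
    have XN: "(\<lambda>u. X (fst u)) \<in> borel_measurable N"
      unfolding N_def by measurable
    have "(\<integral>\<^sup>+t. ennreal (exp (- (\<Sum>e\<in>?E. x e * t e))) \<partial>M) =
        (\<integral>\<^sup>+u. ennreal (exp (- (\<Sum>e\<in>?E. x e * \<tau> u e))) \<partial>N)"
      unfolding M_def by (rule nn_integral_distr[OF \<tau>_measurable]) (simp only: measurable_distr_eq1 measurable_exp_sum)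
    also have "\<dots> = (\<integral>\<^sup>+u. X (fst u) * Y (fst u) (snd u) \<partial>N)"
      unfolding split X_def Y_def
      by (simp add: ennreal_mult'[symmetric] exp_add[symmetric])
    also have "\<dots> = (\<integral>\<^sup>+t. \<integral>\<^sup>+w. X t * Y t w \<partial>?K \<partial>L)"
      using K.nn_integral_fst[of "\<lambda>u. X (fst u) * Y (fst u) (snd u)" L] XN
      unfolding N_def[symmetric] by simp
    \<comment> \<open>The inner integral is evaluated where the weights of the selected face form a
      triangle, that is for almost every \<open>t\<close>; here the invariant on faces
      enters.\<close>
    also have "\<dots> = (\<integral>\<^sup>+t. ennreal (S powr - \<beta>) * ennreal (exp (- (\<Sum>e\<in>E. y e * t e))) \<partial>L)"
    proof (rule nn_integral_cong_AE)
      show "AE t in L. (\<integral>\<^sup>+w. X t * Y t w \<partial>?K) =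
          ennreal (S powr - \<beta>) * ennreal (exp (- (\<Sum>e\<in>E. y e * t e)))"
        using L_abc
      proof eventually_elim
        case (elim t)
        have "(\<integral>\<^sup>+w. X t * Y t w \<partial>?K) = X t * ennreal (S powr - \<beta> *
            exp (- (p * q * t {a, b} + q * r * t {b, c} + p * r * t {a, c}) / S))"
          using nn_integral_kernel_heron[OF p_q_r_S_def(4) pos(4) \<beta> elim]
          by (simp add: nn_integral_cmult Y_def da_def db_def dc_def)
        also have "\<dots> = ennreal (S powr - \<beta>) * ennreal (exp (- (\<Sum>e\<in>E. y e * t e)))"
          unfolding yt X_def minus_add_distrib[of "\<Sum>e\<in>E. x e * t e"] exp_add minus_divide_left
          by (simp add: ennreal_mult'[symmetric] mult_ac)
        finally show ?case .
      qed
    qed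
    also have "\<dots> = ennreal (S powr - \<beta>) * (\<integral>\<^sup>+t. ennreal (exp (- (\<Sum>e\<in>E. y e * t e))) \<partial>L)"
      by (rule nn_integral_cmult) measurable
    also have "\<dots> = ennreal (S powr - \<beta> * spanning_tree_poly G y powr - \<beta>)"
      by (simp add: L_int[OF y] ennreal_mult'[symmetric])
    also have "S powr - \<beta> * spanning_tree_poly G y powr - \<beta> = (S * spanning_tree_poly G y) powr - \<beta>"
      using pos spanning_tree_poly_pos[OF fcg, of y] y by (simp add: powr_mult V_E_def)
    also have "spanning_tree_poly G y = spanning_tree_poly G (\<lambda>e. x e + z e)"
      by (rule spanning_tree_poly_cong) (simp add: y_def V_E_def)
    also have "S * \<dots> = spanning_tree_poly ?H x"
      unfolding G using V E abc abcV abcE vV pos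
      by (intro spanning_tree_poly_star_triangle[symmetric]) (auto simp: p_q_r_S_def z_def)
    finally show ?thesis .
  qed
  have "sets M = sets (PiM ?E (\<lambda>_. borel))"
    by (simp only: M_def sets_distr)
  with M_nonneg M_heron M_int show ?thesis
    unfolding V_E_def laplace_representation_def ugraph.simps by blast
qed

section \<open>Induction over the network and complete monotonicity\<close>

lemma plane_apollonian_laplace_representation:
  assumes "plane_apollonian G F" "1 < \<beta>"
  shows "\<exists>M. laplace_representation \<beta> G F M"
  using assms(1)
proof induction
  case (triangle a b c)
  then show ?case
    using \<open>1 < \<beta>\<close> by (rule laplace_representation_triangle)
next
  case (insert_vertex G F a b c v)
  then obtain M where "laplace_representation \<beta> G F M" by blast
  with insert_vertex.hyps \<open>1 < \<beta>\<close> show ?case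
    by (intro laplace_representation_insert_vertex)
qed

theorem corollary5p1:
  fixes A :: "'v ugraph"
  assumes "apollonian_network A"
  shows "(\<forall>\<beta>::real. \<beta> > 1 \<longrightarrow>
            completely_monotone (edges A) (\<lambda>x. spanning_tree_poly A x powr (- \<beta>))) \<and>
         (\<forall>\<beta>::real. 1 < \<beta> \<and> \<beta> < 3 / 2 \<longrightarrow> A \<in> cm_graphs \<beta>)"
proof -
  obtain F where F: "plane_apollonian A F"
    using assms by (auto simp: apollonian_network_def)
  have A: "finite_connected_graph A" and fin: "finite (edges A)"
    using apollonian_network_finite_connected[OF assms] finite_connected_graph_edges by auto
  have "completely_monotone (edges A) (\<lambda>x. spanning_tree_poly A x powr - \<beta>)" if \<beta>: "1 < \<beta>" for \<beta> :: real
  proof (rule completely_monotone_alternating_differences[OF fin])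
    have "spanning_tree_poly A \<in> poly_functions"
      unfolding spanning_tree_poly_def
      by (intro poly_functions_sum poly_functions_prod poly_functions.var)
    then show "smooth_on_orthant (edges A) (\<lambda>x. spanning_tree_poly A x powr - \<beta>)"
      by (rule smooth_on_orthant_poly_powr) (rule spanning_tree_poly_pos[OF A])
    obtain M where M: "laplace_representation \<beta> A F M"
      using plane_apollonian_laplace_representation[OF F \<beta>] by blast
    then have setsM: "sets M = sets (PiM (edges A) (\<lambda>_. borel))"
      by (simp add: laplace_representation_def)
    show "alternating_differences (edges A) (\<lambda>x. spanning_tree_poly A x powr - \<beta>)"
    proof (rule alternating_differences_laplace[OF fin, of M])
      show "(\<lambda>t. t e) \<in> borel_measurable M" if "e \<in> edges A" for e
        using measurable_component_singleton[OF that, of "\<lambda>_. borel"]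
        by (simp add: measurable_cong_sets[OF setsM refl])
    qed (use M in \<open>auto simp: laplace_representation_def\<close>)
  qed
  with A show ?thesis
    by (auto simp: cm_graphs_def)
qed

end
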